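(* The variance $\sigma_{\mathcal{E}}^2(x^{(1)},x^{(2)})=\operatorname{Var}\big(\mathcal{E}(x^{(1)},x^{(2)})\big)$ of the error process $\mathcal{E}=\tilde f-f$ depends on $(x^{(1)},x^{(2)})$ only through the magnitudes $r_1=\|x^{(1)}-z^*\|_2$, $r_2=\|x^{(2)}-z^*\|_2$ and the angle $\theta$ between $x^{(1)}-z^*$ and $x^{(2)}-z^*$, and $$\begin{aligned}\sigma^2_{\mathcal{E}}(r_1,r_2,\theta)={}&2\Big(h(0)-h\big(2(r_1^2+r_2^2-2r_1r_2\cos\theta)\big)\Big)\\&-4\Big(h'(0)-2h'\big(r_1^2+r_2^2\big)\Big)\Big(r_1^2+r_2^2-2r_1r_2\cos\theta\Big)\\&+4\Big(h''(0)-2h''\big(r_1^2+r_2^2\big)\Big)\Big((r_1^2+r_2^2)^2-4r_1^2r_2^2\cos^2\theta\Big).\end{aligned}$$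
   Context: Let $D\ge 1$ and write points of $\mathbb{R}^D\times\mathbb{R}^D$ as $x=(x^{(1)},x^{(2)})$, with $x^{flip}=(x^{(2)},x^{(1)})$. A real-valued random field is Gaussian if every finite linear combination of its values is a (possibly degenerate) Gaussian random variable. Let $u$ be a mean-zero isotropic Gaussian field on $\mathbb{R}^D\times\mathbb{R}^D$ with covariance function $k_u(x,y)=h(\|x-y\|_2^2)$, where $h:[0,\infty)\to\mathbb{R}$. The field $f(x)=u(x)-u(x^{flip})$ is called a block isotropic Gaussian field with base field $u$; its covariance function is denoted $k_f$. Standing smoothness assumption: $k_u$ (hence $k_f$) is four times continuously differentiable, and $h$ is twice continuously differentiable on $[0,\infty)$. Derivatives of $f$ are taken in the mean-square ($L^2(\Omega)$) sense. Fix $z^*\in\mathbb{R}^D$ and $z=(z^*,z^* )$. Define $$g_i=\partial_{x^{(1)}_i}f(x)\big|_{x=z},\quad H^{(1,1)}_{i,j}=\partial_{x^{(1)}_i}\partial_{x^{(1)}_j}f(x)\big|_{x=z},\quad H^{(1,2)}_{i,j}=\partial_{x^{(1)}_i}\partial_{x^{(2)}_j}f(x)\big|_{x=z}.$$ The second-order (skew-symmetric) Taylor approximation of $f$ at $z$ is $$\tilde f(x)=g^{\mathsf T}(v-w)+\tfrac12\big(v^{\mathsf T}H^{(1,1)}v-w^{\mathsf T}H^{(1,1)}w\big)+v^{\mathsf T}H^{(1,2)}w,\qquad v=x^{(1)}-z^*,\ w=x^{(2)}-z^*.$$ If one of the two displacement vectors is zero, the angle $\theta$ may be taken arbitrary.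 *)

theory Defs
  imports "HOL-Probability.Probability"
begin

text \<open>A random field is a map \<open>F :: 'p \<Rightarrow> 'w \<Rightarrow> real\<close>, where \<open>F x\<close> is a real random variable on the
  probability space \<open>M :: 'w measure\<close>. The space of pairs \<open>x = (x\<^sup>1, x\<^sup>2)\<close> is the product type
  \<open>(real ^ 'n) \<times> (real ^ 'n)\<close>, whose library norm is the Euclidean one.\<close>

definition gaussian_rv :: "'w measure \<Rightarrow> ('w \<Rightarrow> real) \<Rightarrow> bool" where
  "gaussian_rv M X \<longleftrightarrow> X \<in> borel_measurable M \<and>
     ((\<exists>\<mu> \<sigma>. \<sigma> > 0 \<and> distributed M lborel X (\<lambda>t. ennreal (normal_density \<mu> \<sigma> t))) \<or>
      (\<exists>\<mu>. AE \<omega> in M. X \<omega> = \<mu>))"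

definition gaussian_field :: "'w measure \<Rightarrow> ('p \<Rightarrow> 'w \<Rightarrow> real) \<Rightarrow> bool" where
  "gaussian_field M F \<longleftrightarrow>
     (\<forall>I c. finite I \<longrightarrow> gaussian_rv M (\<lambda>\<omega>. \<Sum>x\<in>I. c x * F x \<omega>))"

definition cov :: "'w measure \<Rightarrow> ('w \<Rightarrow> real) \<Rightarrow> ('w \<Rightarrow> real) \<Rightarrow> real" where
  "cov M X Y = prob_space.expectation M
     (\<lambda>\<omega>. (X \<omega> - prob_space.expectation M X) * (Y \<omega> - prob_space.expectation M Y))"

definition cov_fun :: "'w measure \<Rightarrow> ('p \<Rightarrow> 'w \<Rightarrow> real) \<Rightarrow> 'p \<Rightarrow> 'p \<Rightarrow> real" where
  "cov_fun M F x y = cov M (F x) (F y)"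

definition isotropic_gaussian_field ::
    "'w measure \<Rightarrow> (real \<Rightarrow> real) \<Rightarrow> ('p::real_normed_vector \<Rightarrow> 'w \<Rightarrow> real) \<Rightarrow> bool" where
  "isotropic_gaussian_field M h u \<longleftrightarrow>
     gaussian_field M u \<and>
     (\<forall>x. prob_space.expectation M (u x) = 0) \<and>
     (\<forall>x y. cov_fun M u x y = h ((norm (x - y))\<^sup>2))"

definition block_field :: "('a \<times> 'a \<Rightarrow> 'w \<Rightarrow> real) \<Rightarrow> 'a \<times> 'a \<Rightarrow> 'w \<Rightarrow> real" where
  "block_field u x \<omega> = u x \<omega> - u (prod.swap x) \<omega>"

text \<open>\<open>times_cont_diff k F\<close>: \<open>F\<close> is of class \<open>C\<^sup>k\<close> on the whole space.\<close>

fun times_cont_diff :: "nat \<Rightarrow> ('a::real_normed_vector \<Rightarrow> real) \<Rightarrow> bool" where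
  "times_cont_diff 0 F \<longleftrightarrow> continuous_on UNIV F"
| "times_cont_diff (Suc k) F \<longleftrightarrow>
     (\<forall>x. F differentiable (at x)) \<and>
     (\<forall>v. times_cont_diff k (\<lambda>x. frechet_derivative F (at x) v))"

definition square_integrable :: "'w measure \<Rightarrow> ('w \<Rightarrow> real) \<Rightarrow> bool" where
  "square_integrable M X \<longleftrightarrow> X \<in> borel_measurable M \<and> integrable M (\<lambda>\<omega>. (X \<omega>)\<^sup>2)"

text \<open>\<open>X\<close> is the directional derivative of \<open>F\<close> at \<open>x\<close> along \<open>e\<close> in mean square. The square integrability
  requirements are needed because the Bochner integral of a non-integrable function is 0.\<close>

definition has_ms_deriv ::
    "'w measure \<Rightarrow> ('p::real_vector \<Rightarrow> 'w \<Rightarrow> real) \<Rightarrow> ('w \<Rightarrow> real) \<Rightarrow> 'p \<Rightarrow> 'p \<Rightarrow> bool" where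
  "has_ms_deriv M F X e x \<longleftrightarrow>
     (\<forall>y. square_integrable M (F y)) \<and> square_integrable M X \<and>
     ((\<lambda>t::real. \<integral>\<omega>. ((F (x + t *\<^sub>R e) \<omega> - F x \<omega>) / t - X \<omega>)\<^sup>2 \<partial>M) \<longlongrightarrow> 0) (at 0)"

text \<open>Mean-square derivatives are unique only up to null sets; a version is selected, in the same style
  as \<^const>\<open>frechet_derivative\<close>. The resulting field can be differentiated again.\<close>

definition ms_deriv ::
    "'w measure \<Rightarrow> 'p::real_vector \<Rightarrow> ('p \<Rightarrow> 'w \<Rightarrow> real) \<Rightarrow> 'p \<Rightarrow> 'w \<Rightarrow> real" where
  "ms_deriv M e F x = (SOME X. has_ms_deriv M F X e x)"

definition dir1 :: "'n::finite \<Rightarrow> (real ^ 'n) \<times> (real ^ 'n)" where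
  "dir1 i = (axis i 1, 0)"

definition dir2 :: "'n::finite \<Rightarrow> (real ^ 'n) \<times> (real ^ 'n)" where
  "dir2 i = (0, axis i 1)"

definition grad1 ::
    "'w measure \<Rightarrow> ((real ^ 'n) \<times> (real ^ 'n) \<Rightarrow> 'w \<Rightarrow> real) \<Rightarrow> real ^ 'n::finite \<Rightarrow> 'w \<Rightarrow> real ^ 'n" where
  "grad1 M f zs \<omega> = (\<chi> i. ms_deriv M (dir1 i) f (zs, zs) \<omega>)"

definition hess11 ::
    "'w measure \<Rightarrow> ((real ^ 'n) \<times> (real ^ 'n) \<Rightarrow> 'w \<Rightarrow> real) \<Rightarrow> real ^ 'n::finite \<Rightarrow> 'w \<Rightarrow> real ^ 'n ^ 'n" where
  "hess11 M f zs \<omega> = (\<chi> i j. ms_deriv M (dir1 i) (ms_deriv M (dir1 j) f) (zs, zs) \<omega>)"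

definition hess12 ::
    "'w measure \<Rightarrow> ((real ^ 'n) \<times> (real ^ 'n) \<Rightarrow> 'w \<Rightarrow> real) \<Rightarrow> real ^ 'n::finite \<Rightarrow> 'w \<Rightarrow> real ^ 'n ^ 'n" where
  "hess12 M f zs \<omega> = (\<chi> i j. ms_deriv M (dir1 i) (ms_deriv M (dir2 j) f) (zs, zs) \<omega>)"

definition taylor2 ::
    "'w measure \<Rightarrow> ((real ^ 'n) \<times> (real ^ 'n) \<Rightarrow> 'w \<Rightarrow> real) \<Rightarrow> real ^ 'n::finite \<Rightarrow>
     (real ^ 'n) \<times> (real ^ 'n) \<Rightarrow> 'w \<Rightarrow> real" where
  "taylor2 M f zs x \<omega> =
     (let v = fst x - zs; w = snd x - zs;
          g = grad1 M f zs \<omega>; H11 = hess11 M f zs \<omega>; H12 = hess12 M f zs \<omega>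
      in g \<bullet> (v - w) + (1/2) * (v \<bullet> (H11 *v v) - w \<bullet> (H11 *v w)) + v \<bullet> (H12 *v w))"

definition taylor_error ::
    "'w measure \<Rightarrow> ((real ^ 'n) \<times> (real ^ 'n) \<Rightarrow> 'w \<Rightarrow> real) \<Rightarrow> real ^ 'n::finite \<Rightarrow>
     (real ^ 'n) \<times> (real ^ 'n) \<Rightarrow> 'w \<Rightarrow> real" where
  "taylor_error M f zs x \<omega> = taylor2 M f zs x \<omega> - f x \<omega>"

text \<open>\<open>\<theta>\<close> is arbitrary if one of the vectors vanishes, and need not be normalised to \<open>[0, \<pi>]\<close>.\<close>

definition is_angle :: "real \<Rightarrow> 'a::real_inner \<Rightarrow> 'a \<Rightarrow> bool" where
  "is_angle \<theta> v w \<longleftrightarrow> (v \<noteq> 0 \<and> w \<noteq> 0 \<longrightarrow> cos \<theta> = (v \<bullet> w) / (norm v * norm w))"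

end

theory Submission
  imports Defs
begin

text \<open>
  Write \<open>x = z + a\<close> with \<open>a = (v, w)\<close>, let \<open>a' = (w, v)\<close> be the swapped displacement, and put
  \<open>d = a - a'\<close> and \<open>s = a + a'\<close>. Since \<open>f = u - u \<circ> swap\<close> and \<open>z\<close> is fixed by the swap, the linear part
  of the Taylor polynomial is the derivative of \<open>u\<close> at \<open>z\<close> along \<open>d\<close>, and the quadratic part is half the
  second derivative along \<open>d\<close> and \<open>s\<close>, by the factorisation of a difference of squares. The vectors
  \<open>d\<close> and \<open>s\<close> are orthogonal because \<open>a\<close> and \<open>a'\<close> have the same norm. Orthogonality makes the two parts
  uncorrelated, removes the mixed terms of the covariance derivatives, and gives the second moments
  \<open>- 2 h'(0) |d|\<^sup>2\<close> and \<open>h''(0) |d|\<^sup>2 |s|\<^sup>2\<close>. The covariance of the polynomial with \<open>f x\<close> needs only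
  first and second derivatives of \<open>h(|x|\<^sup>2)\<close>. Everything is a function of \<open>|v|\<^sup>2 + |w|\<^sup>2\<close> and \<open>v \<bullet> w\<close>.

  Two analytic points lie behind this computation. The first is that the derivatives exist. This is
  Loeve's criterion \<open>ms_derivative_exists\<close>, based on the completeness of \<open>L\<^sup>2\<close>
  (\<open>l2_complete\<close>), and it is applied to \<open>u\<close> and then to its first derivatives, which form stationary
  fields again; the second application uses that the covariance is four times continuously
  differentiable. The second is that the derivatives in the Taylor polynomial are chosen versions,
  determined only almost surely and taken coordinate by coordinate. They are handled through Loeve's
  isometry: a variable in the closed span of the field is determined almost surely by its
  covariances with the field (\<open>represents_unique\<close>). Comparing covariance functions identifies the
  coordinate expression with the two directional derivatives (\<open>represents_taylor2\<close>), and
  \<open>taylor_polynomial_norm\<close> and \<open>variance_taylor_error\<close> finish the calculation.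
\<close>

section \<open>The inner product of square-integrable random variables\<close>

text \<open>An inner product on functions rather than on classes modulo null sets: a mean-square derivative
  is a chosen version, so the development keeps versions and passes between them by almost sure
  equality.\<close>

definition l2_inner :: "'w measure \<Rightarrow> ('w \<Rightarrow> real) \<Rightarrow> ('w \<Rightarrow> real) \<Rightarrow> real" where
  "l2_inner M X Y = (\<integral>\<omega>. X \<omega> * Y \<omega> \<partial>M)"

lemma square_integrable_product:
  assumes "square_integrable M X" "square_integrable M Y"
  shows "integrable M (\<lambda>\<omega>. X \<omega> * Y \<omega>)"
proof (rule Bochner_Integration.integrable_bound)
  show "integrable M (\<lambda>\<omega>. (X \<omega>)\<^sup>2 + (Y \<omega>)\<^sup>2)"
    using assms by (auto simp: square_integrable_def)
  show "(\<lambda>\<omega>. X \<omega> * Y \<omega>) \<in> borel_measurable M"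
    using assms by (auto simp: square_integrable_def)
  have "\<bar>a * b\<bar> \<le> a\<^sup>2 + b\<^sup>2" for a b :: real
  proof -
    have "2 * \<bar>a * b\<bar> \<le> a\<^sup>2 + b\<^sup>2"
      using sum_squares_bound[of "\<bar>a\<bar>" "\<bar>b\<bar>"] by (simp add: abs_mult)
    then show ?thesis using abs_ge_zero[of "a * b"] by linarith
  qed
  then show "AE \<omega> in M. norm (X \<omega> * Y \<omega>) \<le> norm ((X \<omega>)\<^sup>2 + (Y \<omega>)\<^sup>2)"
    by simp
qed

lemma square_integrable_add [simp]:
  assumes "square_integrable M X" "square_integrable M Y"
  shows "square_integrable M (\<lambda>\<omega>. X \<omega> + Y \<omega>)"
proof -
  have "integrable M (\<lambda>\<omega>. (X \<omega>)\<^sup>2 + (Y \<omega>)\<^sup>2 + 2 * (X \<omega> * Y \<omega>))"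
    using assms square_integrable_product[OF assms] by (auto simp: square_integrable_def)
  then show ?thesis
    using assms by (auto simp: square_integrable_def power2_sum mult.assoc)
qed

lemma square_integrable_cmult [simp]:
  "square_integrable M X \<Longrightarrow> square_integrable M (\<lambda>\<omega>. c * X \<omega>)"
  by (auto simp: square_integrable_def power_mult_distrib)

lemma square_integrable_divide [simp]:
  "square_integrable M X \<Longrightarrow> square_integrable M (\<lambda>\<omega>. X \<omega> / c)"
  using square_integrable_cmult[of M X "inverse c"] by (simp add: divide_inverse mult.commute)

lemma square_integrable_diff [simp]:
  assumes "square_integrable M X" "square_integrable M Y"
  shows "square_integrable M (\<lambda>\<omega>. X \<omega> - Y \<omega>)"
  using square_integrable_add[OF assms(1) square_integrable_cmult[OF assms(2), of "-1"]] by simp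

lemma square_integrable_sum [simp]:
  assumes "\<And>i. i \<in> I \<Longrightarrow> square_integrable M (X i)"
  shows "square_integrable M (\<lambda>\<omega>. \<Sum>i\<in>I. X i \<omega>)"
proof (cases "finite I")
  case True
  then show ?thesis
    using assms by (induction I) (auto simp: square_integrable_def[of M "\<lambda>_. 0"])
qed (simp add: square_integrable_def)

lemma square_integrable_const [simp]:
  "prob_space M \<Longrightarrow> square_integrable M (\<lambda>_. c)"
  by (simp add: square_integrable_def prob_space_def finite_measure.integrable_const)

lemma l2_inner_commute: "l2_inner M X Y = l2_inner M Y X"
  by (simp add: l2_inner_def mult.commute)

lemma l2_inner_add_left:
  "square_integrable M X \<Longrightarrow> square_integrable M Y \<Longrightarrow> square_integrable M Z \<Longrightarrow>
    l2_inner M (\<lambda>\<omega>. X \<omega> + Y \<omega>) Z = l2_inner M X Z + l2_inner M Y Z"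
  by (simp add: l2_inner_def distrib_right square_integrable_product)

lemma l2_inner_diff_left:
  "square_integrable M X \<Longrightarrow> square_integrable M Y \<Longrightarrow> square_integrable M Z \<Longrightarrow>
    l2_inner M (\<lambda>\<omega>. X \<omega> - Y \<omega>) Z = l2_inner M X Z - l2_inner M Y Z"
  by (simp add: l2_inner_def left_diff_distrib square_integrable_product)

lemma l2_inner_cmult_left: "l2_inner M (\<lambda>\<omega>. c * X \<omega>) Z = c * l2_inner M X Z"
  by (simp add: l2_inner_def mult.assoc)

lemma l2_inner_divide_left: "l2_inner M (\<lambda>\<omega>. X \<omega> / c) Z = l2_inner M X Z / c"
  by (simp add: l2_inner_def)

lemma l2_inner_sum_left:
  "(\<And>i. i \<in> I \<Longrightarrow> square_integrable M (X i)) \<Longrightarrow> square_integrable M Z \<Longrightarrow>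
    l2_inner M (\<lambda>\<omega>. \<Sum>i\<in>I. X i \<omega>) Z = (\<Sum>i\<in>I. l2_inner M (X i) Z)"
  by (simp add: l2_inner_def sum_distrib_right square_integrable_product)

lemma l2_inner_add_right:
  "square_integrable M X \<Longrightarrow> square_integrable M Y \<Longrightarrow> square_integrable M Z \<Longrightarrow>
    l2_inner M Z (\<lambda>\<omega>. X \<omega> + Y \<omega>) = l2_inner M Z X + l2_inner M Z Y"
  by (simp add: l2_inner_commute[of M Z] l2_inner_add_left)

lemma l2_inner_diff_right:
  "square_integrable M X \<Longrightarrow> square_integrable M Y \<Longrightarrow> square_integrable M Z \<Longrightarrow>
    l2_inner M Z (\<lambda>\<omega>. X \<omega> - Y \<omega>) = l2_inner M Z X - l2_inner M Z Y"
  by (simp add: l2_inner_commute[of M Z] l2_inner_diff_left)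

lemma l2_inner_cmult_right: "l2_inner M Z (\<lambda>\<omega>. c * X \<omega>) = c * l2_inner M Z X"
  by (simp add: l2_inner_commute[of M Z] l2_inner_cmult_left)

lemma l2_inner_divide_right: "l2_inner M Z (\<lambda>\<omega>. X \<omega> / c) = l2_inner M Z X / c"
  by (simp add: l2_inner_commute[of M Z] l2_inner_divide_left)

lemmas l2_inner_simps =
  l2_inner_add_left l2_inner_diff_left l2_inner_cmult_left l2_inner_divide_left
  l2_inner_add_right l2_inner_diff_right l2_inner_cmult_right l2_inner_divide_right
  square_integrable_add square_integrable_diff square_integrable_cmult square_integrable_divide

lemma l2_inner_self: "l2_inner M X X = (\<integral>\<omega>. (X \<omega>)\<^sup>2 \<partial>M)"
  by (simp add: l2_inner_def power2_eq_square)

lemma l2_inner_self_nonneg: "0 \<le> l2_inner M X X"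
  by (simp add: l2_inner_self)

lemma l2_inner_Cauchy_Schwarz:
  assumes X: "square_integrable M X" and Y: "square_integrable M Y"
  shows "(l2_inner M X Y)\<^sup>2 \<le> l2_inner M X X * l2_inner M Y Y"
proof -
  define a b c where "a = l2_inner M X X" and "b = l2_inner M X Y" and "c = l2_inner M Y Y"
  have *: "0 \<le> a - 2 * t * b + t\<^sup>2 * c" for t
  proof -
    have "l2_inner M (\<lambda>\<omega>. X \<omega> - t * Y \<omega>) (\<lambda>\<omega>. X \<omega> - t * Y \<omega>) = a - 2 * t * b + t\<^sup>2 * c"
      using X Y by (simp add: l2_inner_simps a_def b_def c_def l2_inner_commute[of M Y X]
          power2_eq_square algebra_simps)
    then show ?thesis using l2_inner_self_nonneg[of M "\<lambda>\<omega>. X \<omega> - t * Y \<omega>"] by simp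
  qed
  have "0 \<le> c" by (simp add: c_def l2_inner_self_nonneg)
  show ?thesis
  proof (cases "c = 0")
    case True
    have "b = 0"
    proof (rule ccontr)
      assume "b \<noteq> 0"
      then show False using *[of "(a + 1) / (2 * b)"] True by (simp add: field_simps)
    qed
    then show ?thesis using True by (simp flip: b_def c_def)
  next
    case False
    then have "0 < c" using \<open>0 \<le> c\<close> by simp
    have "a - 2 * (b / c) * b + (b / c)\<^sup>2 * c = a - b\<^sup>2 / c"
      using \<open>0 < c\<close> by (simp add: field_simps power2_eq_square)
    then have "b\<^sup>2 / c \<le> a" using *[of "b / c"] by simp
    then show ?thesis
      using \<open>0 < c\<close> by (simp add: pos_divide_le_eq flip: a_def b_def c_def)
  qed
qed

lemma l2_zero_imp_AE_eq:
  assumes "square_integrable M X" "square_integrable M Y"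
    and "l2_inner M (\<lambda>\<omega>. X \<omega> - Y \<omega>) (\<lambda>\<omega>. X \<omega> - Y \<omega>) = 0"
  shows "AE \<omega> in M. X \<omega> = Y \<omega>"
proof -
  have "integrable M (\<lambda>\<omega>. (X \<omega> - Y \<omega>)\<^sup>2)"
    using square_integrable_diff[OF assms(1,2)] by (simp add: square_integrable_def)
  then have "AE \<omega> in M. (X \<omega> - Y \<omega>)\<^sup>2 = 0"
    using assms(3) integral_nonneg_eq_0_iff_AE[of M "\<lambda>\<omega>. (X \<omega> - Y \<omega>)\<^sup>2"]
    by (simp add: l2_inner_self)
  then show ?thesis by simp
qed

lemma l2_inner_cong_AE:
  assumes "square_integrable M X" "square_integrable M X'" "square_integrable M Y"
    and "AE \<omega> in M. X \<omega> = X' \<omega>"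
  shows "l2_inner M X Y = l2_inner M X' Y"
  unfolding l2_inner_def
  using assms by (intro integral_cong_AE) (auto simp: square_integrable_def)

lemma l2_dist_triangle:
  assumes "square_integrable M X" "square_integrable M Y" "square_integrable M Z"
  shows "l2_inner M (\<lambda>\<omega>. X \<omega> - Z \<omega>) (\<lambda>\<omega>. X \<omega> - Z \<omega>) \<le>
    2 * l2_inner M (\<lambda>\<omega>. X \<omega> - Y \<omega>) (\<lambda>\<omega>. X \<omega> - Y \<omega>) +
    2 * l2_inner M (\<lambda>\<omega>. Y \<omega> - Z \<omega>) (\<lambda>\<omega>. Y \<omega> - Z \<omega>)"
  using l2_inner_self_nonneg[of M "\<lambda>\<omega>. (X \<omega> - Y \<omega>) - (Y \<omega> - Z \<omega>)"] assms
  by (simp add: l2_inner_simps l2_inner_commute[of M Y X] l2_inner_commute[of M Z X]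
      l2_inner_commute[of M Z Y])

lemma tendsto_l2_inner:
  assumes "\<And>t. square_integrable M (Q t)" "square_integrable M X" "square_integrable M Y"
    and lim: "((\<lambda>t. l2_inner M (\<lambda>\<omega>. Q t \<omega> - X \<omega>) (\<lambda>\<omega>. Q t \<omega> - X \<omega>)) \<longlongrightarrow> 0) F"
  shows "((\<lambda>t. l2_inner M (Q t) Y) \<longlongrightarrow> l2_inner M X Y) F"
proof -
  have "((\<lambda>t. (l2_inner M (Q t) Y - l2_inner M X Y)\<^sup>2) \<longlongrightarrow> 0) F"
  proof (rule tendsto_sandwich[OF _ _ tendsto_const])
    show "((\<lambda>t. l2_inner M (\<lambda>\<omega>. Q t \<omega> - X \<omega>) (\<lambda>\<omega>. Q t \<omega> - X \<omega>) * l2_inner M Y Y) \<longlongrightarrow> 0) F"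
      using tendsto_mult_left_zero[OF lim] by simp
    show "\<forall>\<^sub>F t in F. (l2_inner M (Q t) Y - l2_inner M X Y)\<^sup>2
        \<le> l2_inner M (\<lambda>\<omega>. Q t \<omega> - X \<omega>) (\<lambda>\<omega>. Q t \<omega> - X \<omega>) * l2_inner M Y Y"
    proof (intro always_eventually allI)
      fix t
      show "(l2_inner M (Q t) Y - l2_inner M X Y)\<^sup>2
        \<le> l2_inner M (\<lambda>\<omega>. Q t \<omega> - X \<omega>) (\<lambda>\<omega>. Q t \<omega> - X \<omega>) * l2_inner M Y Y"
        using l2_inner_Cauchy_Schwarz[of M "\<lambda>\<omega>. Q t \<omega> - X \<omega>" Y] assms(1-3)
        by (simp add: l2_inner_diff_left[of M "Q t" X Y] square_integrable_diff)
    qed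
  qed simp
  from tendsto_real_sqrt[OF this] have "((\<lambda>t. l2_inner M (Q t) Y - l2_inner M X Y) \<longlongrightarrow> 0) F"
    by (simp add: tendsto_rabs_zero_iff)
  then show ?thesis using LIM_zero_iff by blast
qed

lemma tendsto_l2_norm:
  assumes "\<And>t. square_integrable M (Q t)" "square_integrable M X"
    and lim: "((\<lambda>t. l2_inner M (\<lambda>\<omega>. Q t \<omega> - X \<omega>) (\<lambda>\<omega>. Q t \<omega> - X \<omega>)) \<longlongrightarrow> 0) F"
  shows "((\<lambda>t. l2_inner M (Q t) (Q t)) \<longlongrightarrow> l2_inner M X X) F"
proof -
  have "((\<lambda>t. l2_inner M (\<lambda>\<omega>. Q t \<omega> - X \<omega>) (\<lambda>\<omega>. Q t \<omega> - X \<omega>) + 2 * l2_inner M (Q t) X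
      - l2_inner M X X) \<longlongrightarrow> 0 + 2 * l2_inner M X X - l2_inner M X X) F"
    by (intro tendsto_intros lim tendsto_l2_inner assms)
  then show ?thesis
    using assms(1,2) l2_inner_commute[of M X "Q t" for t] by (simp add: l2_inner_simps)
qed

text \<open>The Riesz-Fischer theorem. An \<open>L\<^sup>2\<close> Cauchy sequence is \<open>L\<^sup>1\<close> Cauchy by Cauchy-Schwarz, hence has
  a subsequence that converges almost surely; Fatou's lemma along this subsequence bounds the \<open>L\<^sup>2\<close>
  distance of each member to the limit.\<close>

lemma l2_complete:
  fixes X :: "nat \<Rightarrow> 'w \<Rightarrow> real"
  assumes "prob_space M" and X: "\<And>n. square_integrable M (X n)"
    and Cauchy: "\<And>e. 0 < e \<Longrightarrow> \<exists>N. \<forall>m\<ge>N. \<forall>n\<ge>N.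
      l2_inner M (\<lambda>\<omega>. X m \<omega> - X n \<omega>) (\<lambda>\<omega>. X m \<omega> - X n \<omega>) < e"
  obtains Y where "square_integrable M Y"
    and "(\<lambda>n. l2_inner M (\<lambda>\<omega>. X n \<omega> - Y \<omega>) (\<lambda>\<omega>. X n \<omega> - Y \<omega>)) \<longlonglongrightarrow> 0"
proof -
  interpret prob_space M by fact
  have meas [measurable]: "X n \<in> borel_measurable M" for n
    using X by (simp add: square_integrable_def)
  have int: "integrable M (X n)" for n
    using X[of n] by (simp add: square_integrable_def square_integrable_imp_integrable)
  have "\<exists>N. \<forall>m\<ge>N. \<forall>n\<ge>N. (LINT \<omega>|M. norm (X m \<omega> - X n \<omega>)) < e" if "0 < e" for e
  proof -
    obtain N where N: "\<And>m n. m \<ge> N \<Longrightarrow> n \<ge> N \<Longrightarrow>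
        l2_inner M (\<lambda>\<omega>. X m \<omega> - X n \<omega>) (\<lambda>\<omega>. X m \<omega> - X n \<omega>) < e\<^sup>2"
      using Cauchy[of "e\<^sup>2"] \<open>0 < e\<close> by auto
    have "(LINT \<omega>|M. norm (X m \<omega> - X n \<omega>)) < e" if "m \<ge> N" "n \<ge> N" for m n
    proof -
      have abs: "square_integrable M (\<lambda>\<omega>. \<bar>X m \<omega> - X n \<omega>\<bar>)"
        using square_integrable_diff[OF X X, of m n] by (simp add: square_integrable_def)
      have "(LINT \<omega>|M. norm (X m \<omega> - X n \<omega>))\<^sup>2 = (l2_inner M (\<lambda>\<omega>. \<bar>X m \<omega> - X n \<omega>\<bar>) (\<lambda>_. 1))\<^sup>2"
        by (simp add: l2_inner_def)
      also have "\<dots> \<le> l2_inner M (\<lambda>\<omega>. \<bar>X m \<omega> - X n \<omega>\<bar>) (\<lambda>\<omega>. \<bar>X m \<omega> - X n \<omega>\<bar>)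
          * l2_inner M (\<lambda>_. 1) (\<lambda>_. 1)"
        using abs by (intro l2_inner_Cauchy_Schwarz) (auto simp: square_integrable_const prob_space_axioms)
      also have "\<dots> = l2_inner M (\<lambda>\<omega>. X m \<omega> - X n \<omega>) (\<lambda>\<omega>. X m \<omega> - X n \<omega>)"
        by (simp add: l2_inner_def prob_space)
      also have "\<dots> < e\<^sup>2" using N that by simp
      finally show ?thesis
        using \<open>0 < e\<close> by (simp add: power2_less_imp_less)
    qed
    then show ?thesis by blast
  qed
  with int obtain r where r: "strict_mono r" "AE \<omega> in M. Cauchy (\<lambda>i. X (r i) \<omega>)"
    by (rule cauchy_L1_AE_cauchy_subseq)
  define Y where "Y \<omega> = lim (\<lambda>i. X (r i) \<omega>)" for \<omega>
  have [measurable]: "Y \<in> borel_measurable M"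
    unfolding Y_def by measurable
  have ae: "AE \<omega> in M. (\<lambda>i. X (r i) \<omega>) \<longlonglongrightarrow> Y \<omega>"
    using r(2) by eventually_elim (simp add: Y_def Cauchy_convergent_iff convergent_LIMSEQ_iff)
  have fatou: "(\<integral>\<^sup>+\<omega>. ennreal ((X n \<omega> - Y \<omega>)\<^sup>2) \<partial>M) \<le> ennreal e"
    if "0 \<le> e" and N: "\<And>k. k \<ge> N \<Longrightarrow> l2_inner M (\<lambda>\<omega>. X n \<omega> - X k \<omega>) (\<lambda>\<omega>. X n \<omega> - X k \<omega>) \<le> e" for n N e
  proof -
    have "(\<integral>\<^sup>+\<omega>. ennreal ((X n \<omega> - Y \<omega>)\<^sup>2) \<partial>M)
        = (\<integral>\<^sup>+\<omega>. liminf (\<lambda>i. ennreal ((X n \<omega> - X (r i) \<omega>)\<^sup>2)) \<partial>M)"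
    proof (rule nn_integral_cong_AE)
      show "AE \<omega> in M. ennreal ((X n \<omega> - Y \<omega>)\<^sup>2) = liminf (\<lambda>i. ennreal ((X n \<omega> - X (r i) \<omega>)\<^sup>2))"
        using ae
      proof eventually_elim
        case (elim \<omega>)
        have "(\<lambda>i. ennreal ((X n \<omega> - X (r i) \<omega>)\<^sup>2)) \<longlonglongrightarrow> ennreal ((X n \<omega> - Y \<omega>)\<^sup>2)"
          by (intro tendsto_intros elim)
        from lim_imp_Liminf[OF _ this] show ?case by simp
      qed
    qed
    also have "\<dots> \<le> liminf (\<lambda>i. \<integral>\<^sup>+\<omega>. ennreal ((X n \<omega> - X (r i) \<omega>)\<^sup>2) \<partial>M)"
      by (intro nn_integral_liminf) measurable
    also have "\<dots> \<le> liminf (\<lambda>i. ennreal e)"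
    proof (rule Liminf_mono)
      show "\<forall>\<^sub>F i in sequentially. (\<integral>\<^sup>+\<omega>. ennreal ((X n \<omega> - X (r i) \<omega>)\<^sup>2) \<partial>M) \<le> ennreal e"
        using eventually_ge_at_top[of N]
      proof eventually_elim
        case (elim i)
        then have "r i \<ge> N" using seq_suble[OF r(1), of i] by linarith
        moreover have "(\<integral>\<^sup>+\<omega>. ennreal ((X n \<omega> - X (r i) \<omega>)\<^sup>2) \<partial>M)
            = ennreal (l2_inner M (\<lambda>\<omega>. X n \<omega> - X (r i) \<omega>) (\<lambda>\<omega>. X n \<omega> - X (r i) \<omega>))"
          using square_integrable_diff[OF X X, of n "r i"]
          by (subst nn_integral_eq_integral) (auto simp: square_integrable_def l2_inner_self)
        ultimately show ?case using N by (simp add: ennreal_leI)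
      qed
    qed
    finally show ?thesis by (simp add: Liminf_const)
  qed
  have Y: "square_integrable M (\<lambda>\<omega>. X n \<omega> - Y \<omega>)"
    and small: "l2_inner M (\<lambda>\<omega>. X n \<omega> - Y \<omega>) (\<lambda>\<omega>. X n \<omega> - Y \<omega>) \<le> e"
    if "0 \<le> e" and "\<And>k. k \<ge> N \<Longrightarrow> l2_inner M (\<lambda>\<omega>. X n \<omega> - X k \<omega>) (\<lambda>\<omega>. X n \<omega> - X k \<omega>) \<le> e" for n N e
  proof -
    have le: "(\<integral>\<^sup>+\<omega>. ennreal ((X n \<omega> - Y \<omega>)\<^sup>2) \<partial>M) \<le> ennreal e"
      using fatou that by blast
    then have int: "integrable M (\<lambda>\<omega>. (X n \<omega> - Y \<omega>)\<^sup>2)"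
      using le_less_trans[OF le ennreal_less_top] by (intro integrableI_bounded) simp_all
    then show "square_integrable M (\<lambda>\<omega>. X n \<omega> - Y \<omega>)"
      by (simp add: square_integrable_def)
    have "ennreal (\<integral>\<omega>. (X n \<omega> - Y \<omega>)\<^sup>2 \<partial>M) \<le> ennreal e"
      using le nn_integral_eq_integral[OF int] by simp
    then show "l2_inner M (\<lambda>\<omega>. X n \<omega> - Y \<omega>) (\<lambda>\<omega>. X n \<omega> - Y \<omega>) \<le> e"
      using \<open>0 \<le> e\<close> by (simp add: l2_inner_self)
  qed
  show thesis
  proof
    obtain N where N: "\<And>m n. m \<ge> N \<Longrightarrow> n \<ge> N \<Longrightarrow>
        l2_inner M (\<lambda>\<omega>. X m \<omega> - X n \<omega>) (\<lambda>\<omega>. X m \<omega> - X n \<omega>) < 1"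
      using Cauchy[of 1] by auto
    have "square_integrable M (\<lambda>\<omega>. X N \<omega> - (X N \<omega> - Y \<omega>))"
      by (intro square_integrable_diff X Y[of 1 N]) (use N in \<open>auto intro: less_imp_le\<close>)
    then show "square_integrable M Y" by simp
    show "(\<lambda>n. l2_inner M (\<lambda>\<omega>. X n \<omega> - Y \<omega>) (\<lambda>\<omega>. X n \<omega> - Y \<omega>)) \<longlonglongrightarrow> 0"
    proof (rule LIMSEQ_I)
      fix e :: real assume "0 < e"
      then obtain N where N: "\<And>m n. m \<ge> N \<Longrightarrow> n \<ge> N \<Longrightarrow>
          l2_inner M (\<lambda>\<omega>. X m \<omega> - X n \<omega>) (\<lambda>\<omega>. X m \<omega> - X n \<omega>) < e / 2"
        using Cauchy[of "e / 2"] by auto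
      have "norm (l2_inner M (\<lambda>\<omega>. X n \<omega> - Y \<omega>) (\<lambda>\<omega>. X n \<omega> - Y \<omega>) - 0) < e" if "n \<ge> N" for n
      proof -
        have "l2_inner M (\<lambda>\<omega>. X n \<omega> - Y \<omega>) (\<lambda>\<omega>. X n \<omega> - Y \<omega>) \<le> e / 2"
          using small[of "e / 2" N n] N that \<open>0 < e\<close> by (auto intro: less_imp_le)
        then show ?thesis using \<open>0 < e\<close> by (simp add: l2_inner_self_nonneg)
      qed
      then show "\<exists>N. \<forall>n\<ge>N. norm (l2_inner M (\<lambda>\<omega>. X n \<omega> - Y \<omega>) (\<lambda>\<omega>. X n \<omega> - Y \<omega>) - 0) < e"
        by blast
    qed
  qed
qed

section \<open>Mean-square derivatives\<close>

lemma has_ms_deriv_l2: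
  "has_ms_deriv M F X e x \<longleftrightarrow>
     (\<forall>y. square_integrable M (F y)) \<and> square_integrable M X \<and>
     ((\<lambda>t. l2_inner M (\<lambda>\<omega>. (F (x + t *\<^sub>R e) \<omega> - F x \<omega>) / t - X \<omega>)
        (\<lambda>\<omega>. (F (x + t *\<^sub>R e) \<omega> - F x \<omega>) / t - X \<omega>)) \<longlongrightarrow> 0) (at 0)"
  by (simp add: has_ms_deriv_def l2_inner_self)

lemma has_ms_deriv_square_integrable:
  assumes "has_ms_deriv M F X e x"
  shows "square_integrable M (F y)" "square_integrable M X"
  using assms by (simp_all add: has_ms_deriv_def)

text \<open>The inner product with a fixed variable is continuous, so it commutes with mean-square
  differentiation. Every covariance below that involves a derivative of the field comes from this.\<close>

lemma has_ms_deriv_inner: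
  assumes X: "has_ms_deriv M F X e x" and Y: "square_integrable M Y"
    and D: "((\<lambda>t. l2_inner M (F (x + t *\<^sub>R e)) Y) has_real_derivative D) (at 0)"
  shows "l2_inner M X Y = D"
proof (rule tendsto_unique[of "at (0::real)"])
  note sq = has_ms_deriv_square_integrable[OF X]
  show "((\<lambda>t. l2_inner M (\<lambda>\<omega>. (F (x + t *\<^sub>R e) \<omega> - F x \<omega>) / t) Y) \<longlongrightarrow> l2_inner M X Y) (at 0)"
    using X Y sq by (intro tendsto_l2_inner) (auto simp: has_ms_deriv_l2)
  show "((\<lambda>t. l2_inner M (\<lambda>\<omega>. (F (x + t *\<^sub>R e) \<omega> - F x \<omega>) / t) Y) \<longlongrightarrow> D) (at 0)"
    using D sq Y by (simp add: DERIV_def l2_inner_simps)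
qed simp

text \<open>Convergence in \<open>L\<^sup>2\<close> carries norms along, so the second moment of a derivative is a limit of
  second moments of increments of the field.\<close>

lemma has_ms_deriv_norm:
  assumes X: "has_ms_deriv M F X e x"
  shows "((\<lambda>t. l2_inner M (\<lambda>\<omega>. F (x + t *\<^sub>R e) \<omega> - F x \<omega>) (\<lambda>\<omega>. F (x + t *\<^sub>R e) \<omega> - F x \<omega>) / t\<^sup>2)
    \<longlongrightarrow> l2_inner M X X) (at 0)"
proof -
  note sq = has_ms_deriv_square_integrable[OF X]
  have "((\<lambda>t. l2_inner M (\<lambda>\<omega>. (F (x + t *\<^sub>R e) \<omega> - F x \<omega>) / t)
      (\<lambda>\<omega>. (F (x + t *\<^sub>R e) \<omega> - F x \<omega>) / t)) \<longlongrightarrow> l2_inner M X X) (at 0)"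
    using X sq by (intro tendsto_l2_norm) (auto simp: has_ms_deriv_l2)
  then show ?thesis
    by (simp add: l2_inner_divide_left l2_inner_divide_right power2_eq_square)
qed

lemma ms_deriv_works:
  "has_ms_deriv M F X e x \<Longrightarrow> has_ms_deriv M F (ms_deriv M e F x) e x"
  unfolding ms_deriv_def by (rule someI[of "\<lambda>X. has_ms_deriv M F X e x"])

lemma has_ms_deriv_unique:
  assumes X: "has_ms_deriv M F X e x" and Y: "has_ms_deriv M F Y e x"
  shows "AE \<omega> in M. X \<omega> = Y \<omega>"
proof -
  note sq = has_ms_deriv_square_integrable[OF X] has_ms_deriv_square_integrable[OF Y]
  let ?Q = "\<lambda>t \<omega>. (F (x + t *\<^sub>R e) \<omega> - F x \<omega>) / t"
  have "((\<lambda>t. l2_inner M (?Q t) Z) \<longlongrightarrow> l2_inner M X Z) (at 0)"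
    "((\<lambda>t. l2_inner M (?Q t) Z) \<longlongrightarrow> l2_inner M Y Z) (at 0)" if "square_integrable M Z" for Z
    using X Y sq that by (auto simp: has_ms_deriv_l2 intro!: tendsto_l2_inner)
  then have "l2_inner M X Z = l2_inner M Y Z" if "square_integrable M Z" for Z
    using that tendsto_unique[OF trivial_limit_at] by blast
  then show ?thesis
    using sq by (intro l2_zero_imp_AE_eq) (simp_all add: l2_inner_simps)
qed

lemma has_ms_deriv_cong_AE:
  assumes F: "has_ms_deriv M F X e x"
    and "\<And>y. square_integrable M (G y)" and FG: "\<And>y. AE \<omega> in M. F y \<omega> = G y \<omega>"
  shows "has_ms_deriv M G X e x"
proof -
  have "(\<integral>\<omega>. ((F (x + t *\<^sub>R e) \<omega> - F x \<omega>) / t - X \<omega>)\<^sup>2 \<partial>M) =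
        (\<integral>\<omega>. ((G (x + t *\<^sub>R e) \<omega> - G x \<omega>) / t - X \<omega>)\<^sup>2 \<partial>M)" for t
  proof (rule integral_cong_AE)
    have [measurable]: "F y \<in> borel_measurable M" "G y \<in> borel_measurable M" "X \<in> borel_measurable M" for y
      using has_ms_deriv_square_integrable[OF F] assms(2) by (simp_all add: square_integrable_def)
    show "(\<lambda>\<omega>. ((F (x + t *\<^sub>R e) \<omega> - F x \<omega>) / t - X \<omega>)\<^sup>2) \<in> borel_measurable M"
      "(\<lambda>\<omega>. ((G (x + t *\<^sub>R e) \<omega> - G x \<omega>) / t - X \<omega>)\<^sup>2) \<in> borel_measurable M"
      by measurable
    show "AE \<omega> in M. ((F (x + t *\<^sub>R e) \<omega> - F x \<omega>) / t - X \<omega>)\<^sup>2 =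
        ((G (x + t *\<^sub>R e) \<omega> - G x \<omega>) / t - X \<omega>)\<^sup>2"
      using FG[of "x + t *\<^sub>R e"] FG[of x] by eventually_elim simp
  qed
  then show ?thesis using F assms(2) by (simp add: has_ms_deriv_def)
qed

lemma has_ms_deriv_linear_compose:
  assumes "linear L" "has_ms_deriv M F X (L e) (L x)"
  shows "has_ms_deriv M (\<lambda>p. F (L p)) X e x"
  using assms by (simp add: has_ms_deriv_def linear_add linear_scale)

lemma has_ms_deriv_diff:
  assumes F: "has_ms_deriv M F X e x" and G: "has_ms_deriv M G Y e x"
  shows "has_ms_deriv M (\<lambda>p \<omega>. F p \<omega> - G p \<omega>) (\<lambda>\<omega>. X \<omega> - Y \<omega>) e x"
proof -
  note sq = has_ms_deriv_square_integrable[OF F] has_ms_deriv_square_integrable[OF G]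
  define A B where "A t \<omega> = (F (x + t *\<^sub>R e) \<omega> - F x \<omega>) / t - X \<omega>"
    and "B t \<omega> = (G (x + t *\<^sub>R e) \<omega> - G x \<omega>) / t - Y \<omega>" for t \<omega>
  have [simp]: "square_integrable M (A t)" "square_integrable M (B t)" for t
    unfolding A_def B_def using sq by auto
  have "((\<lambda>t. l2_inner M (\<lambda>\<omega>. A t \<omega> - B t \<omega>) (\<lambda>\<omega>. A t \<omega> - B t \<omega>)) \<longlongrightarrow> 0) (at 0)"
  proof (rule tendsto_sandwich[OF _ _ tendsto_const])
    show "((\<lambda>t. 2 * l2_inner M (A t) (A t) + 2 * l2_inner M (B t) (B t)) \<longlongrightarrow> 0) (at 0)"
    proof -
      have "((\<lambda>t. l2_inner M (A t) (A t)) \<longlongrightarrow> 0) (at 0)" "((\<lambda>t. l2_inner M (B t) (B t)) \<longlongrightarrow> 0) (at 0)"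
        using F G unfolding has_ms_deriv_l2 A_def[abs_def] B_def[abs_def] by blast+
      from tendsto_add[OF this[THEN tendsto_mult_right_zero[of _ _ 2]]] show ?thesis by simp
    qed
    have "l2_inner M (\<lambda>\<omega>. A t \<omega> - B t \<omega>) (\<lambda>\<omega>. A t \<omega> - B t \<omega>)
        \<le> 2 * l2_inner M (A t) (A t) + 2 * l2_inner M (B t) (B t)" for t
      using l2_inner_self_nonneg[of M "\<lambda>\<omega>. A t \<omega> + B t \<omega>"]
      by (simp add: l2_inner_simps l2_inner_commute[of M "B t" "A t"])
    then show "\<forall>\<^sub>F t in at 0. l2_inner M (\<lambda>\<omega>. A t \<omega> - B t \<omega>) (\<lambda>\<omega>. A t \<omega> - B t \<omega>)
        \<le> 2 * l2_inner M (A t) (A t) + 2 * l2_inner M (B t) (B t)"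
      by simp
  qed (simp add: l2_inner_self_nonneg)
  moreover have "(\<lambda>\<omega>. A t \<omega> - B t \<omega>) = (\<lambda>\<omega>. ((F (x + t *\<^sub>R e) \<omega> - G (x + t *\<^sub>R e) \<omega>)
      - (F x \<omega> - G x \<omega>)) / t - (X \<omega> - Y \<omega>))" for t
    by (rule ext) (simp add: A_def B_def diff_divide_distrib)
  ultimately show ?thesis unfolding has_ms_deriv_l2 using sq by simp
qed

lemma mean_value_from_zero:
  fixes f f' :: "real \<Rightarrow> real"
  assumes f: "\<And>x. (f has_real_derivative f' x) (at x)"
  obtains \<xi> where "\<bar>\<xi>\<bar> \<le> \<bar>s\<bar>" "f s - f 0 = s * f' \<xi>"
proof (cases s "0::real" rule: linorder_cases)
  case less
  then obtain z where "s < z" "z < 0" "f 0 - f s = (0 - s) * f' z"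
    using MVT2[of s 0 f f'] f by blast
  then show ?thesis by (intro that[of z]) auto
next
  case greater
  then obtain z where "0 < z" "z < s" "f s - f 0 = (s - 0) * f' z"
    using MVT2[of 0 s f f'] f by blast
  then show ?thesis by (intro that[of z]) auto
qed (use that[of 0] in auto)

text \<open>The quotient is the mixed second difference of \<open>(s, t) \<mapsto> \<rho> (s - t)\<close>. Two applications of the
  mean value theorem, first in \<open>s\<close> and then in \<open>t\<close>, turn it into the value of \<open>- \<rho>''\<close> at a point
  near 0. It is essential that \<open>s\<close> and \<open>t\<close> vary independently: a second-order expansion of \<open>\<rho>\<close> at 0
  alone would not control the quotient when \<open>t\<close> is much smaller than \<open>s\<close>.\<close>

lemma mixed_difference_quotient_limit:
  fixes \<rho> \<rho>' \<rho>'' :: "real \<Rightarrow> real"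
  assumes \<rho>: "\<And>t. (\<rho> has_real_derivative \<rho>' t) (at t)"
    and \<rho>': "\<And>t. (\<rho>' has_real_derivative \<rho>'' t) (at t)"
    and cont: "isCont \<rho>'' 0" and "0 < \<epsilon>"
  obtains \<delta> where "0 < \<delta>" and "\<And>s t. s \<noteq> 0 \<Longrightarrow> t \<noteq> 0 \<Longrightarrow> \<bar>s\<bar> < \<delta> \<Longrightarrow> \<bar>t\<bar> < \<delta> \<Longrightarrow>
    \<bar>(\<rho> (s - t) - \<rho> s - \<rho> (- t) + \<rho> 0) / (s * t) + \<rho>'' 0\<bar> < \<epsilon>"
proof -
  obtain d where "0 < d" and d: "\<And>x. \<bar>x\<bar> < d \<Longrightarrow> \<bar>\<rho>'' x - \<rho>'' 0\<bar> < \<epsilon>"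
    using cont \<open>0 < \<epsilon>\<close> unfolding continuous_at_eps_delta dist_real_def by auto
  show thesis
  proof (rule that[of "d / 2"])
    fix s t :: real
    assume st: "s \<noteq> 0" "t \<noteq> 0" "\<bar>s\<bar> < d / 2" "\<bar>t\<bar> < d / 2"
    have "((\<lambda>a. \<rho> (a - t) - \<rho> a) has_real_derivative (\<rho>' (x - t) - \<rho>' x)) (at x)" for x
      by (auto intro!: derivative_eq_intros DERIV_chain2[OF \<rho>] \<rho>)
    then obtain \<xi> where \<xi>: "\<bar>\<xi>\<bar> \<le> \<bar>s\<bar>"
      "(\<rho> (s - t) - \<rho> s) - (\<rho> (0 - t) - \<rho> 0) = s * (\<rho>' (\<xi> - t) - \<rho>' \<xi>)"
      by (rule mean_value_from_zero[where f = "\<lambda>a. \<rho> (a - t) - \<rho> a"])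
    have "((\<lambda>a. \<rho>' (a + \<xi>)) has_real_derivative \<rho>'' (x + \<xi>)) (at x)" for x
      using \<rho>' DERIV_shift by blast
    then obtain \<eta> where \<eta>: "\<bar>\<eta>\<bar> \<le> \<bar>- t\<bar>"
      "\<rho>' (- t + \<xi>) - \<rho>' (0 + \<xi>) = (- t) * \<rho>'' (\<eta> + \<xi>)"
      by (rule mean_value_from_zero[where f = "\<lambda>a. \<rho>' (a + \<xi>)"])
    have "\<rho> (s - t) - \<rho> s - \<rho> (- t) + \<rho> 0 = - (s * t) * \<rho>'' (\<eta> + \<xi>)"
    proof -
      have "\<rho>' (\<xi> - t) - \<rho>' \<xi> = - t * \<rho>'' (\<eta> + \<xi>)" using \<eta>(2) by simp
      with \<xi>(2) have "(\<rho> (s - t) - \<rho> s) - (\<rho> (0 - t) - \<rho> 0) = s * (- t * \<rho>'' (\<eta> + \<xi>))"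
        by (simp only:)
      then show ?thesis by simp
    qed
    then have "(\<rho> (s - t) - \<rho> s - \<rho> (- t) + \<rho> 0) / (s * t) + \<rho>'' 0 = - (\<rho>'' (\<eta> + \<xi>) - \<rho>'' 0)"
      using st by simp
    moreover have "\<bar>\<eta> + \<xi>\<bar> < d" using \<xi>(1) \<eta>(1) st by linarith
    ultimately show "\<bar>(\<rho> (s - t) - \<rho> s - \<rho> (- t) + \<rho> 0) / (s * t) + \<rho>'' 0\<bar> < \<epsilon>"
      using d[of "\<eta> + \<xi>"] by (simp only: abs_minus_cancel)
  qed (use \<open>0 < d\<close> in simp)
qed

text \<open>Loeve's criterion, for a field whose covariance along a line is stationary. The inner product of
  two difference quotients converges as both steps tend to 0, so the quotients are \<open>L\<^sup>2\<close> Cauchy, and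
  completeness supplies the derivative.\<close>

lemma ms_derivative_exists:
  fixes F :: "'p::real_vector \<Rightarrow> 'w \<Rightarrow> real"
  assumes "prob_space M" and F: "\<And>y. square_integrable M (F y)"
    and kernel: "\<And>s t. l2_inner M (F (x + s *\<^sub>R e)) (F (x + t *\<^sub>R e)) = \<rho> (s - t)"
    and \<rho>: "\<And>t. (\<rho> has_real_derivative \<rho>' t) (at t)"
    and \<rho>': "\<And>t. (\<rho>' has_real_derivative \<rho>'' t) (at t)"
    and cont: "isCont \<rho>'' 0"
  shows "has_ms_deriv M F (ms_deriv M e F x) e x"
proof -
  define Q where "Q t \<omega> = (F (x + t *\<^sub>R e) \<omega> - F x \<omega>) / t" for t \<omega>
  have Q [simp]: "square_integrable M (Q t)" for t
    unfolding Q_def using F by auto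
  have QQ: "l2_inner M (Q s) (Q t) = (\<rho> (s - t) - \<rho> s - \<rho> (- t) + \<rho> 0) / (s * t)" for s t
  proof -
    have "l2_inner M (Q s) (Q t) = (l2_inner M (F (x + s *\<^sub>R e)) (F (x + t *\<^sub>R e))
        - l2_inner M (F (x + s *\<^sub>R e)) (F (x + 0 *\<^sub>R e))
        - l2_inner M (F (x + 0 *\<^sub>R e)) (F (x + t *\<^sub>R e))
        + l2_inner M (F (x + 0 *\<^sub>R e)) (F (x + 0 *\<^sub>R e))) / (s * t)"
      unfolding Q_def using F by (simp add: l2_inner_simps diff_divide_distrib add_divide_distrib mult.commute)
    then show ?thesis unfolding kernel by simp
  qed
  have Cauchy: "\<exists>\<delta>>0. \<forall>s t. s \<noteq> 0 \<longrightarrow> t \<noteq> 0 \<longrightarrow> \<bar>s\<bar> < \<delta> \<longrightarrow> \<bar>t\<bar> < \<delta> \<longrightarrow>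
      l2_inner M (\<lambda>\<omega>. Q s \<omega> - Q t \<omega>) (\<lambda>\<omega>. Q s \<omega> - Q t \<omega>) < \<epsilon>" if "0 < \<epsilon>" for \<epsilon>
  proof -
    obtain \<delta> where "0 < \<delta>" and \<delta>: "\<And>s t. s \<noteq> 0 \<Longrightarrow> t \<noteq> 0 \<Longrightarrow> \<bar>s\<bar> < \<delta> \<Longrightarrow> \<bar>t\<bar> < \<delta> \<Longrightarrow>
        \<bar>l2_inner M (Q s) (Q t) + \<rho>'' 0\<bar> < \<epsilon> / 4"
      using mixed_difference_quotient_limit[OF \<rho> \<rho>' cont, of "\<epsilon> / 4"] \<open>0 < \<epsilon>\<close> unfolding QQ by auto
    have "l2_inner M (\<lambda>\<omega>. Q s \<omega> - Q t \<omega>) (\<lambda>\<omega>. Q s \<omega> - Q t \<omega>) < \<epsilon>"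
      if "s \<noteq> 0" "t \<noteq> 0" "\<bar>s\<bar> < \<delta>" "\<bar>t\<bar> < \<delta>" for s t
    proof -
      have "l2_inner M (\<lambda>\<omega>. Q s \<omega> - Q t \<omega>) (\<lambda>\<omega>. Q s \<omega> - Q t \<omega>)
        = l2_inner M (Q s) (Q s) + l2_inner M (Q t) (Q t) - 2 * l2_inner M (Q s) (Q t)"
        by (simp add: l2_inner_simps l2_inner_commute[of M "Q t" "Q s"])
      then show ?thesis
        using \<delta>[of s s] \<delta>[of t t] \<delta>[of s t] that by linarith
    qed
    then show ?thesis using \<open>0 < \<delta>\<close> by blast
  qed
  \<comment> \<open>Completeness is about sequences, so the limit is built along the steps \<open>1 / (n + 1)\<close>.\<close>
  define \<tau> :: "nat \<Rightarrow> real" where "\<tau> n = inverse (real (Suc n))" for n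
  have \<tau>_nz: "\<tau> n \<noteq> 0" for n by (simp add: \<tau>_def)
  have \<tau>_small: "\<exists>N. \<forall>n\<ge>N. \<bar>\<tau> n\<bar> < \<delta>" if "0 < \<delta>" for \<delta>
    using LIMSEQ_D[OF LIMSEQ_inverse_real_of_nat that] by (simp add: \<tau>_def)
  have "\<exists>N. \<forall>m\<ge>N. \<forall>n\<ge>N. l2_inner M (\<lambda>\<omega>. Q (\<tau> m) \<omega> - Q (\<tau> n) \<omega>) (\<lambda>\<omega>. Q (\<tau> m) \<omega> - Q (\<tau> n) \<omega>) < \<epsilon>"
    if "0 < \<epsilon>" for \<epsilon>
  proof -
    obtain \<delta> where \<delta>: "0 < \<delta>" "\<And>s t. s \<noteq> 0 \<Longrightarrow> t \<noteq> 0 \<Longrightarrow> \<bar>s\<bar> < \<delta> \<Longrightarrow> \<bar>t\<bar> < \<delta> \<Longrightarrow>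
        l2_inner M (\<lambda>\<omega>. Q s \<omega> - Q t \<omega>) (\<lambda>\<omega>. Q s \<omega> - Q t \<omega>) < \<epsilon>"
      using Cauchy[OF \<open>0 < \<epsilon>\<close>] by auto
    then show ?thesis using \<tau>_small[OF \<delta>(1)] \<tau>_nz by blast
  qed
  then obtain X where X: "square_integrable M X"
    "(\<lambda>n. l2_inner M (\<lambda>\<omega>. Q (\<tau> n) \<omega> - X \<omega>) (\<lambda>\<omega>. Q (\<tau> n) \<omega> - X \<omega>)) \<longlonglongrightarrow> 0"
    by (rule l2_complete[OF \<open>prob_space M\<close> Q])
  have "((\<lambda>t. l2_inner M (\<lambda>\<omega>. Q t \<omega> - X \<omega>) (\<lambda>\<omega>. Q t \<omega> - X \<omega>)) \<longlongrightarrow> 0) (at 0)"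
  proof (rule LIM_I)
    fix \<epsilon> :: real assume "0 < \<epsilon>"
    then obtain \<delta> where "0 < \<delta>" and \<delta>: "\<And>s t. s \<noteq> 0 \<Longrightarrow> t \<noteq> 0 \<Longrightarrow> \<bar>s\<bar> < \<delta> \<Longrightarrow> \<bar>t\<bar> < \<delta> \<Longrightarrow>
        l2_inner M (\<lambda>\<omega>. Q s \<omega> - Q t \<omega>) (\<lambda>\<omega>. Q s \<omega> - Q t \<omega>) < \<epsilon> / 4"
      using Cauchy[of "\<epsilon> / 4"] by auto
    obtain N1 where N1: "\<And>n. n \<ge> N1 \<Longrightarrow> \<bar>\<tau> n\<bar> < \<delta>"
      using \<tau>_small[OF \<open>0 < \<delta>\<close>] by blast
    obtain N2 where N2: "\<And>n. n \<ge> N2 \<Longrightarrow>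
        l2_inner M (\<lambda>\<omega>. Q (\<tau> n) \<omega> - X \<omega>) (\<lambda>\<omega>. Q (\<tau> n) \<omega> - X \<omega>) < \<epsilon> / 4"
      using LIMSEQ_D[OF X(2), of "\<epsilon> / 4"] \<open>0 < \<epsilon>\<close> by (auto simp: l2_inner_self_nonneg)
    define n where "n = max N1 N2"
    have "norm (l2_inner M (\<lambda>\<omega>. Q t \<omega> - X \<omega>) (\<lambda>\<omega>. Q t \<omega> - X \<omega>) - 0) < \<epsilon>"
      if "t \<noteq> 0" "norm (t - 0) < \<delta>" for t
      using l2_dist_triangle[of M "Q t" "Q (\<tau> n)" X] \<delta>[of t "\<tau> n"] N1[of n] N2[of n] that X(1) \<tau>_nz
      by (simp add: n_def l2_inner_self_nonneg)
    then show "\<exists>r>0. \<forall>t. t \<noteq> 0 \<and> norm (t - 0) < r \<longrightarrow>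
        norm (l2_inner M (\<lambda>\<omega>. Q t \<omega> - X \<omega>) (\<lambda>\<omega>. Q t \<omega> - X \<omega>) - 0) < \<epsilon>"
      using \<open>0 < \<delta>\<close> by blast
  qed
  then have "has_ms_deriv M F X e x"
    using F X(1) by (simp add: has_ms_deriv_l2 Q_def)
  then show ?thesis by (rule ms_deriv_works)
qed

section \<open>The closed span of a random field\<close>

text \<open>\<open>X\<close> lies in the closed linear span of the field \<open>u\<close> and \<open>q y = E (X u(y))\<close>. Membership in the
  closed span is encoded as orthogonality to the orthogonal complement of all \<open>u y\<close>: in this form it
  is plainly stable under linear combinations and mean-square limits. The map that sends \<open>X\<close> to \<open>q\<close>
  is Loeve's isometry onto the reproducing kernel Hilbert space of the covariance.\<close>

definition represents ::
    "'w measure \<Rightarrow> ('p \<Rightarrow> 'w \<Rightarrow> real) \<Rightarrow> ('w \<Rightarrow> real) \<Rightarrow> ('p \<Rightarrow> real) \<Rightarrow> bool" where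
  "represents M u X q \<longleftrightarrow> square_integrable M X \<and>
     (\<forall>Y. square_integrable M Y \<longrightarrow> (\<forall>y. l2_inner M Y (u y) = 0) \<longrightarrow> l2_inner M X Y = 0) \<and>
     (\<forall>y. l2_inner M X (u y) = q y)"

lemma represents_square_integrable: "represents M u X q \<Longrightarrow> square_integrable M X"
  by (simp add: represents_def)

lemma represents_inner: "represents M u X q \<Longrightarrow> l2_inner M X (u y) = q y"
  by (simp add: represents_def)

lemma represents_orthogonal:
  "represents M u X q \<Longrightarrow> square_integrable M Y \<Longrightarrow> (\<And>y. l2_inner M Y (u y) = 0) \<Longrightarrow> l2_inner M X Y = 0"
  by (simp add: represents_def)

lemma represents_point: "square_integrable M (u x) \<Longrightarrow> represents M u (u x) (\<lambda>y. l2_inner M (u x) (u y))"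
  by (simp add: represents_def l2_inner_commute)

lemma represents_diff:
  assumes "\<And>y. square_integrable M (u y)" "represents M u X p" "represents M u Y q"
  shows "represents M u (\<lambda>\<omega>. X \<omega> - Y \<omega>) (\<lambda>y. p y - q y)"
  using assms by (auto simp: represents_def l2_inner_diff_left)

lemma represents_add:
  assumes "\<And>y. square_integrable M (u y)" "represents M u X p" "represents M u Y q"
  shows "represents M u (\<lambda>\<omega>. X \<omega> + Y \<omega>) (\<lambda>y. p y + q y)"
  using assms by (auto simp: represents_def l2_inner_add_left)

lemma represents_cmult:
  assumes "represents M u X p"
  shows "represents M u (\<lambda>\<omega>. c * X \<omega>) (\<lambda>y. c * p y)"
  using assms by (auto simp: represents_def l2_inner_cmult_left)

lemma represents_sum:
  assumes "\<And>y. square_integrable M (u y)" "\<And>i. i \<in> I \<Longrightarrow> represents M u (X i) (p i)"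
  shows "represents M u (\<lambda>\<omega>. \<Sum>i\<in>I. X i \<omega>) (\<lambda>y. \<Sum>i\<in>I. p i y)"
  using assms by (auto simp: represents_def l2_inner_sum_left)

lemma represents_cong_AE:
  assumes "\<And>y. square_integrable M (u y)" "represents M u X p" "square_integrable M X'"
    "AE \<omega> in M. X \<omega> = X' \<omega>"
  shows "represents M u X' p"
  using assms l2_inner_cong_AE[of M X X'] by (simp add: represents_def)

text \<open>Injectivity of Loeve's isometry: the difference of \<open>X\<close> and \<open>Y\<close> is orthogonal to every \<open>u y\<close>,
  and by membership in the closed span it is then orthogonal to itself.\<close>

lemma represents_unique:
  assumes u: "\<And>y. square_integrable M (u y)" and X: "represents M u X q" and Y: "represents M u Y q"
  shows "AE \<omega> in M. X \<omega> = Y \<omega>"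
proof (rule l2_zero_imp_AE_eq)
  have "represents M u (\<lambda>\<omega>. X \<omega> - Y \<omega>) (\<lambda>y. q y - q y)"
    using assms by (rule represents_diff)
  then show "l2_inner M (\<lambda>\<omega>. X \<omega> - Y \<omega>) (\<lambda>\<omega>. X \<omega> - Y \<omega>) = 0"
    by (auto simp: represents_def)
qed (use X Y in \<open>auto simp: represents_def\<close>)

text \<open>For a centred field the constant 1 is orthogonal to every \<open>u y\<close>, hence to the closed span.\<close>

lemma represents_mean_zero:
  assumes "prob_space M" "\<And>y. (\<integral>\<omega>. u y \<omega> \<partial>M) = 0" "represents M u X q"
  shows "(\<integral>\<omega>. X \<omega> \<partial>M) = 0"
  using represents_orthogonal[OF assms(3), of "\<lambda>_. 1"] assms(1,2)
  by (simp add: square_integrable_const l2_inner_def)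

lemma represents_ms_deriv:
  assumes X: "has_ms_deriv M F X e x"
    and F: "\<And>z. represents M u (F z) (Q z)"
    and u: "\<And>y. square_integrable M (u y)"
    and D: "\<And>y. ((\<lambda>t. Q (x + t *\<^sub>R e) y) has_real_derivative q y) (at 0)"
  shows "represents M u X q"
  unfolding represents_def
proof (intro conjI allI impI)
  show "square_integrable M X" by (rule has_ms_deriv_square_integrable[OF X])
  show "l2_inner M X (u y) = q y" for y
    using D[of y] by (intro has_ms_deriv_inner[OF X u]) (simp add: represents_inner[OF F])
  fix Y assume Y: "square_integrable M Y" "\<forall>y. l2_inner M Y (u y) = 0"
  then have "l2_inner M (F z) Y = 0" for z
    using represents_orthogonal[OF F] by blast
  then show "l2_inner M X Y = 0"
    by (intro has_ms_deriv_inner[OF X Y(1)]) simp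
qed

section \<open>Derivatives of an isotropic field\<close>

lemma has_derivative_along_line:
  fixes f :: "'p::real_normed_vector \<Rightarrow> real"
  assumes "(f has_derivative f') (at (x + t *\<^sub>R e))"
  shows "((\<lambda>t. f (x + t *\<^sub>R e)) has_real_derivative f' e) (at t)"
proof -
  interpret f': bounded_linear f' using assms by (rule has_derivative_bounded_linear)
  have "((\<lambda>t. x + t *\<^sub>R e) has_derivative (\<lambda>s. s *\<^sub>R e)) (at t)"
    by (auto intro!: derivative_eq_intros)
  from has_derivative_compose[OF this assms] show ?thesis
    by (simp add: has_field_derivative_def f'.scaleR mult_commute_abs)
qed

lemma has_derivative_radial:
  fixes g g' :: "real \<Rightarrow> real" and x :: "'p::real_inner"
  assumes "\<And>t. 0 \<le> t \<Longrightarrow> (g has_real_derivative g' t) (at t within {0..})"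
  shows "((\<lambda>x. g (x \<bullet> x)) has_derivative (\<lambda>e. g' (x \<bullet> x) * (2 * (x \<bullet> e)))) (at x)"
proof (rule has_derivative_in_compose2[where t = "{0..}" and s = UNIV and g' = "\<lambda>t. (*) (g' t)"])
  show "((\<lambda>x. x \<bullet> x) has_derivative (\<lambda>e. 2 * (x \<bullet> e))) (at x)"
    by (auto intro!: derivative_eq_intros simp: inner_commute)
qed (use assms in \<open>auto simp: has_field_derivative_def\<close>)

text \<open>The link from the multivariate smoothness class to the criterion for mean-square derivatives,
  which is about one real variable.\<close>

lemma times_cont_diff_2_along_line:
  assumes "times_cont_diff 2 G"
  obtains g' g'' :: "real \<Rightarrow> real"
  where "\<And>t. ((\<lambda>t. G (x + t *\<^sub>R e)) has_real_derivative g' t) (at t)"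
    and "\<And>t. (g' has_real_derivative g'' t) (at t)"
    and "continuous_on UNIV g''"
proof -
  let ?G1 = "\<lambda>x. frechet_derivative G (at x) e"
  let ?G2 = "\<lambda>x. frechet_derivative ?G1 (at x) e"
  have "times_cont_diff (Suc (Suc 0)) G" using assms by (simp only: numeral_2_eq_2)
  then have G: "\<And>x. (G has_derivative frechet_derivative G (at x)) (at x)"
    and G1: "\<And>x. (?G1 has_derivative frechet_derivative ?G1 (at x)) (at x)"
    and G2: "continuous_on UNIV ?G2"
    unfolding times_cont_diff.simps using frechet_derivative_works by blast+
  show thesis
  proof (rule that[of "\<lambda>t. ?G1 (x + t *\<^sub>R e)" "\<lambda>t. ?G2 (x + t *\<^sub>R e)"])
    show "continuous_on UNIV (\<lambda>t. ?G2 (x + t *\<^sub>R e))"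
      by (rule continuous_on_compose2[OF G2]) (auto intro!: continuous_intros)
  qed (rule has_derivative_along_line, rule G G1)+
qed

text \<open>The second-order data of a centred isotropic field, with squared distances written as inner
  products. The parameters \<open>h'\<close> and \<open>h''\<close> are the derivatives of \<open>h\<close> on the closed half-line,
  one-sided at 0.\<close>

locale isotropic_field =
  fixes M :: "'w measure" and u :: "'p::real_inner \<Rightarrow> 'w \<Rightarrow> real" and h h' h'' :: "real \<Rightarrow> real"
  assumes prob: "prob_space M"
    and u_sq [simp]: "\<And>x. square_integrable M (u x)"
    and u_mean: "\<And>x. (\<integral>\<omega>. u x \<omega> \<partial>M) = 0"
    and kernel: "\<And>x y. l2_inner M (u x) (u y) = h ((x - y) \<bullet> (x - y))"
    and smooth: "times_cont_diff 4 (\<lambda>p::'p \<times> 'p. h ((fst p - snd p) \<bullet> (fst p - snd p)))"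
    and h': "\<And>t. 0 \<le> t \<Longrightarrow> (h has_real_derivative h' t) (at t within {0..})"
    and h'': "\<And>t. 0 \<le> t \<Longrightarrow> (h' has_real_derivative h'' t) (at t within {0..})"
    and h''_cont: "continuous_on {0..} h''"
begin

text \<open>\<open>D1 a x\<close> and \<open>D2 a b x\<close> are the directional derivatives at \<open>x\<close>, along \<open>a\<close> and along \<open>a\<close> and
  \<open>b\<close>, of the stationary covariance \<open>x \<mapsto> h (x \<bullet> x)\<close>.\<close>

definition D1 :: "'p \<Rightarrow> 'p \<Rightarrow> real" where
  "D1 a x = 2 * h' (x \<bullet> x) * (x \<bullet> a)"

definition D2 :: "'p \<Rightarrow> 'p \<Rightarrow> 'p \<Rightarrow> real" where
  "D2 a b x = 4 * h'' (x \<bullet> x) * (x \<bullet> a) * (x \<bullet> b) + 2 * h' (x \<bullet> x) * (a \<bullet> b)"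

lemma covariance_has_derivative: "((\<lambda>x. h (x \<bullet> x)) has_derivative (\<lambda>a. D1 a x)) (at x)"
  using has_derivative_radial[of h h' x, OF h'] by (simp add: D1_def mult_ac)

lemma D1_has_derivative: "(D1 b has_derivative (\<lambda>a. D2 a b x)) (at x)"
  unfolding D1_def[abs_def]
  by (rule has_derivative_eq_rhs,
      (rule derivative_intros has_derivative_radial[of h' h''] h'' | assumption)+)
     (auto simp: D2_def algebra_simps fun_eq_iff)

lemma D2_minus [simp]: "D2 a b (- x) = D2 a b x"
  by (simp add: D2_def)

text \<open>The two derivatives of \<open>h\<close> are used up in the formula for \<open>D2\<close>. That \<open>D2 b b\<close> can be
  differentiated twice more is what the smoothness of the covariance in both arguments provides:
  differentiate it twice in the first argument along \<open>b\<close>.\<close>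

lemma D2_times_cont_diff: "times_cont_diff 2 (\<lambda>p::'p \<times> 'p. D2 b b (fst p - snd p))"
proof -
  have diff: "((\<lambda>p::'p \<times> 'p. fst p - snd p) has_derivative (\<lambda>q. fst q - snd q)) (at p)" for p
    by (auto intro!: derivative_eq_intros)
  have D: "frechet_derivative (\<lambda>p. f (fst p - snd p)) (at p) (b, 0) = f' (fst p - snd p) b"
    if "\<And>x. (f has_derivative f' x) (at x)" for f :: "'p \<Rightarrow> real" and f' and p :: "'p \<times> 'p"
    using frechet_derivative_at[OF has_derivative_compose[OF diff that], of p, symmetric] by simp
  have "(4::nat) = Suc (Suc 2)" by simp
  from smooth[unfolded this times_cont_diff.simps]
  have "times_cont_diff 2 (\<lambda>p. frechet_derivative (\<lambda>p. frechet_derivative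
      (\<lambda>p::'p \<times> 'p. h ((fst p - snd p) \<bullet> (fst p - snd p))) (at p) (b, 0)) (at p) (b, 0))"
    by blast
  then show ?thesis
    unfolding D[where f = "\<lambda>x. h (x \<bullet> x)", OF covariance_has_derivative] D[OF D1_has_derivative] .
qed

abbreviation U :: "'p \<Rightarrow> 'p \<Rightarrow> 'w \<Rightarrow> real" where
  "U a \<equiv> ms_deriv M a u"

abbreviation W :: "'p \<Rightarrow> 'p \<Rightarrow> 'p \<Rightarrow> 'w \<Rightarrow> real" where
  "W a b \<equiv> ms_deriv M a (U b)"

text \<open>Along a line the covariance of \<open>u\<close> is \<open>t \<mapsto> h (t\<^sup>2 (a \<bullet> a))\<close>, whose two derivatives are \<open>D1 a\<close> and
  \<open>D2 a a\<close>, so the criterion applies.\<close>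

lemma U_has_ms_deriv: "has_ms_deriv M u (U a x) a x"
proof (rule ms_derivative_exists[OF prob])
  show "l2_inner M (u (x + s *\<^sub>R a)) (u (x + t *\<^sub>R a)) = h ((0 + (s - t) *\<^sub>R a) \<bullet> (0 + (s - t) *\<^sub>R a))" for s t
    by (simp add: kernel scaleR_diff_left)
  show "((\<lambda>t. h ((0 + t *\<^sub>R a) \<bullet> (0 + t *\<^sub>R a))) has_real_derivative D1 a (0 + t *\<^sub>R a)) (at t)" for t
    by (rule has_derivative_along_line[OF covariance_has_derivative])
  show "((\<lambda>t. D1 a (0 + t *\<^sub>R a)) has_real_derivative D2 a a (0 + t *\<^sub>R a)) (at t)" for t
    by (rule has_derivative_along_line[OF D1_has_derivative])
  have h'_cont: "continuous_on {0..} h'"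
    by (rule DERIV_continuous_on[where D = h'']) (simp add: h'')
  have "continuous_on UNIV (\<lambda>t. g ((0 + t *\<^sub>R a) \<bullet> (0 + t *\<^sub>R a)))"
    if "continuous_on {0..} g" for g :: "real \<Rightarrow> real"
    by (rule continuous_on_compose2[OF that]) (auto intro!: continuous_intros simp del: inner_scaleR_left inner_scaleR_right)
  from this[OF h'_cont] this[OF h''_cont] have "continuous_on UNIV (\<lambda>t. D2 a a (0 + t *\<^sub>R a))"
    unfolding D2_def by (intro continuous_intros)
  then show "isCont (\<lambda>t. D2 a a (0 + t *\<^sub>R a)) 0"
    by (simp add: continuous_on_eq_continuous_at)
qed simp

lemma U_sq [simp]: "square_integrable M (U a x)"
  by (rule has_ms_deriv_square_integrable[OF U_has_ms_deriv])

lemma represents_u: "represents M u (u x) (\<lambda>y. h ((x - y) \<bullet> (x - y)))"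
  using represents_point[of M u x] by (simp add: kernel)

lemma represents_U: "represents M u (U a x) (\<lambda>y. D1 a (x - y))"
proof (rule represents_ms_deriv[OF U_has_ms_deriv represents_u])
  show "((\<lambda>t. h ((x + t *\<^sub>R a - y) \<bullet> (x + t *\<^sub>R a - y))) has_real_derivative D1 a (x - y)) (at 0)" for y
    using has_derivative_along_line[of "\<lambda>x. h (x \<bullet> x)" _ "x - y" 0 a] covariance_has_derivative[of "x - y"]
    by (simp add: algebra_simps)
qed simp

lemma U_inner_U: "l2_inner M (U a x) (U b y) = - D2 a b (y - x)"
proof (rule has_ms_deriv_inner[OF U_has_ms_deriv])
  have "((\<lambda>t. D1 b ((y - x) + t *\<^sub>R (- a))) has_real_derivative D2 (- a) b (y - x)) (at 0)"
    by (rule has_derivative_along_line) (simp add: D1_has_derivative)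
  moreover have "l2_inner M (u (x + t *\<^sub>R a)) (U b y) = D1 b ((y - x) + t *\<^sub>R (- a))" for t
    by (simp add: l2_inner_commute[of M "u _"] represents_inner[OF represents_U] diff_diff_add)
  ultimately show "((\<lambda>t. l2_inner M (u (x + t *\<^sub>R a)) (U b y)) has_real_derivative - D2 a b (y - x)) (at 0)"
    by (simp add: D2_def algebra_simps)
qed simp

text \<open>The field \<open>U b\<close> is again stationary, with covariance \<open>- D2 b b\<close>, so the criterion applies a
  second time.\<close>

lemma W_has_ms_deriv: "has_ms_deriv M (U b) (W a b x) a x"
proof (rule times_cont_diff_2_along_line[OF D2_times_cont_diff[of b], where x = 0 and e = "(a, 0)"])
  fix g' g'' :: "real \<Rightarrow> real"
  assume g: "\<And>t. ((\<lambda>t. D2 b b (fst (0 + t *\<^sub>R (a, 0)) - snd (0 + t *\<^sub>R (a, 0)))) has_real_derivative g' t) (at t)"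
    "\<And>t. (g' has_real_derivative g'' t) (at t)" "continuous_on UNIV g''"
  show ?thesis
  proof (rule ms_derivative_exists[OF prob])
    show "l2_inner M (U b (x + s *\<^sub>R a)) (U b (x + t *\<^sub>R a)) = - D2 b b ((s - t) *\<^sub>R a)" for s t
      using D2_minus[of b b "(s - t) *\<^sub>R a"]
      by (simp add: U_inner_U algebra_simps)
    show "((\<lambda>t. - D2 b b (t *\<^sub>R a)) has_real_derivative - g' t) (at t)" for t
      using DERIV_minus[OF g(1)] by simp
    show "((\<lambda>t. - g' t) has_real_derivative - g'' t) (at t)" for t
      by (rule DERIV_minus[OF g(2)])
    show "isCont (\<lambda>t. - g'' t) 0"
      using g(3) by (simp add: continuous_on_eq_continuous_at)
  qed simp
qed

lemma W_sq [simp]: "square_integrable M (W a b x)"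
  by (rule has_ms_deriv_square_integrable[OF W_has_ms_deriv])

lemma represents_W: "represents M u (W a b x) (\<lambda>y. D2 a b (x - y))"
proof (rule represents_ms_deriv[OF W_has_ms_deriv represents_U])
  show "((\<lambda>t. D1 b (x + t *\<^sub>R a - y)) has_real_derivative D2 a b (x - y)) (at 0)" for y
    using has_derivative_along_line[of "D1 b" _ "x - y" 0 a] D1_has_derivative[of b "x - y"]
    by (simp add: algebra_simps)
qed simp

lemma U_norm: "l2_inner M (U a x) (U a x) = - 2 * h' 0 * (a \<bullet> a)"
  by (simp add: U_inner_U D2_def)

lemma W_inner_U:
  assumes "a \<bullet> b = 0"
  shows "l2_inner M (W a b x) (U a x) = 0"
proof -
  have "l2_inner M (U a x) (W a b x) = 0"
  proof (rule has_ms_deriv_inner[OF U_has_ms_deriv])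
    have "l2_inner M (u (x + t *\<^sub>R a)) (W a b x) = 0" for t
      using assms by (simp add: l2_inner_commute[of M "u _"] represents_inner[OF represents_W] D2_def)
    then show "((\<lambda>t. l2_inner M (u (x + t *\<^sub>R a)) (W a b x)) has_real_derivative 0) (at 0)"
      by simp
  qed simp
  then show ?thesis by (simp add: l2_inner_commute)
qed

text \<open>The squared increments of \<open>U b\<close> along \<open>a\<close> are computed from \<open>D2 b b\<close>. Since \<open>a\<close> is orthogonal to
  \<open>b\<close>, the term of \<open>D2 b b\<close> with \<open>h''\<close> vanishes on the line along \<open>a\<close>, and the increments reduce to
  difference quotients of \<open>h'\<close> at 0. Thus the fourth derivative of the covariance at the origin is
  found from \<open>h''\<close> alone.\<close>

lemma W_norm:
  assumes "a \<bullet> b = 0"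
  shows "l2_inner M (W a b x) (W a b x) = 4 * h'' 0 * (a \<bullet> a) * (b \<bullet> b)"
proof (rule tendsto_unique[OF trivial_limit_at has_ms_deriv_norm[OF W_has_ms_deriv]])
  have eq: "l2_inner M (\<lambda>\<omega>. U b (x + t *\<^sub>R a) \<omega> - U b x \<omega>) (\<lambda>\<omega>. U b (x + t *\<^sub>R a) \<omega> - U b x \<omega>) / t\<^sup>2
      = 4 * (b \<bullet> b) * ((h' (t\<^sup>2 * (a \<bullet> a)) - h' 0) / t\<^sup>2)" for t
    using assms by (simp add: l2_inner_simps U_inner_U D2_def power2_eq_square algebra_simps diff_divide_distrib)
  have "((\<lambda>t. (h' (t\<^sup>2 * (a \<bullet> a)) - h' 0) / t\<^sup>2) \<longlongrightarrow> (a \<bullet> a) * h'' 0) (at 0)"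
  proof (cases "a = 0")
    case False
    have "((\<lambda>s. (h' s - h' 0) / (s - 0)) \<longlongrightarrow> h'' 0) (at 0 within {0..})"
      using h''[of 0] by (simp add: has_field_derivative_iff)
    moreover have "filterlim (\<lambda>t. t\<^sup>2 * (a \<bullet> a)) (at 0 within {0..}) (at 0)"
    proof -
      have "((\<lambda>t. t\<^sup>2 * (a \<bullet> a)) \<longlongrightarrow> 0\<^sup>2 * (a \<bullet> a)) (at (0::real))"
        by (intro tendsto_intros)
      then show ?thesis
        using False by (auto simp: filterlim_at eventually_at_filter)
    qed
    ultimately have "((\<lambda>t. (h' (t\<^sup>2 * (a \<bullet> a)) - h' 0) / (t\<^sup>2 * (a \<bullet> a) - 0)) \<longlongrightarrow> h'' 0) (at 0)"
      by (rule filterlim_compose)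
    from tendsto_mult_left[OF this, of "a \<bullet> a"] show ?thesis
      using False by simp
  qed simp
  from tendsto_mult_left[OF this, of "4 * (b \<bullet> b)"]
  show "((\<lambda>t. l2_inner M (\<lambda>\<omega>. U b (x + t *\<^sub>R a) \<omega> - U b x \<omega>)
      (\<lambda>\<omega>. U b (x + t *\<^sub>R a) \<omega> - U b x \<omega>) / t\<^sup>2) \<longlongrightarrow> 4 * h'' 0 * (a \<bullet> a) * (b \<bullet> b)) (at 0)"
    unfolding eq by (simp add: mult_ac)
qed

text \<open>For orthogonal directions the cross term vanishes by \<open>W_inner_U\<close>: the covariance of \<open>W d s x\<close>
  with \<open>u\<close> is zero along the whole line through \<open>x\<close> in direction \<open>d\<close>.\<close>

lemma taylor_polynomial_norm:
  assumes "d \<bullet> s = 0"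
  shows "l2_inner M (\<lambda>\<omega>. U d x \<omega> + 1 / 2 * W d s x \<omega>) (\<lambda>\<omega>. U d x \<omega> + 1 / 2 * W d s x \<omega>)
    = - 2 * h' 0 * (d \<bullet> d) + h'' 0 * (d \<bullet> d) * (s \<bullet> s)"
  using assms
  by (simp add: l2_inner_simps U_norm W_norm W_inner_U l2_inner_commute[of M "U d x" "W d s x"])

end

section \<open>The Taylor polynomial of a block field\<close>

lemma sum_bilinear_minor:
  fixes a b p q r s :: "real ^ 'n::finite"
  shows "(\<Sum>i\<in>UNIV. a $ i * (\<Sum>j\<in>UNIV. b $ j * (c * (p $ i * q $ j - r $ i * s $ j))))
    = c * ((p \<bullet> a) * (q \<bullet> b) - (r \<bullet> a) * (s \<bullet> b))"
proof -
  have "(\<Sum>i\<in>UNIV. a $ i * (\<Sum>j\<in>UNIV. b $ j * (c * (p $ i * q $ j - r $ i * s $ j))))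
      = c * ((\<Sum>i\<in>UNIV. \<Sum>j\<in>UNIV. (p $ i * a $ i) * (q $ j * b $ j))
        - (\<Sum>i\<in>UNIV. \<Sum>j\<in>UNIV. (r $ i * a $ i) * (s $ j * b $ j)))"
    by (simp add: sum_distrib_left sum_subtractf [symmetric] algebra_simps)
  then show ?thesis by (simp add: inner_vec_def sum_product)
qed

locale isotropic_field_on_pairs = isotropic_field M u h h' h''
  for M :: "'w measure" and u :: "(real ^ 'n::finite) \<times> (real ^ 'n) \<Rightarrow> 'w \<Rightarrow> real"
    and h h' h'' :: "real \<Rightarrow> real"
begin

abbreviation f :: "(real ^ 'n) \<times> (real ^ 'n) \<Rightarrow> 'w \<Rightarrow> real" where
  "f \<equiv> block_field u"

lemma linear_swap: "linear (prod.swap :: (real ^ 'n) \<times> (real ^ 'n) \<Rightarrow> _)"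
  by (rule linearI) (simp_all add: prod_eq_iff)

text \<open>The block field is \<open>u\<close> minus its composition with the swap, so its derivatives are differences of
  derivatives of \<open>u\<close>, the second one taken along the swapped direction at the swapped point.\<close>

lemma f_has_ms_deriv: "has_ms_deriv M f (ms_deriv M e f x) e x"
  and f_deriv_AE: "AE \<omega> in M. U e x \<omega> - U (prod.swap e) (prod.swap x) \<omega> = ms_deriv M e f x \<omega>"
proof -
  have *: "has_ms_deriv M f (\<lambda>\<omega>. U e x \<omega> - U (prod.swap e) (prod.swap x) \<omega>) e x"
    unfolding block_field_def[abs_def]
    by (intro has_ms_deriv_diff U_has_ms_deriv has_ms_deriv_linear_compose[OF linear_swap])
  then show d: "has_ms_deriv M f (ms_deriv M e f x) e x" by (rule ms_deriv_works)
  show "AE \<omega> in M. U e x \<omega> - U (prod.swap e) (prod.swap x) \<omega> = ms_deriv M e f x \<omega>"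
    by (rule has_ms_deriv_unique[OF * d])
qed

lemma f_deriv_sq [simp]: "square_integrable M (ms_deriv M e f x)"
  by (rule has_ms_deriv_square_integrable[OF f_has_ms_deriv])

lemma represents_f_deriv:
  "represents M u (ms_deriv M e f x) (\<lambda>y. D1 e (x - y) - D1 (prod.swap e) (prod.swap x - y))"
  by (rule represents_cong_AE[OF u_sq represents_diff[OF u_sq represents_U represents_U] f_deriv_sq f_deriv_AE])

text \<open>The second derivative differentiates chosen versions of the first derivatives. These agree
  almost surely with the explicit differences at each point, which is enough because a difference
  quotient involves only two points.\<close>

lemma represents_f_deriv2:
  "represents M u (ms_deriv M a (ms_deriv M b f) x)
    (\<lambda>y. D2 a b (x - y) - D2 (prod.swap a) (prod.swap b) (prod.swap x - y))"
proof -
  have "has_ms_deriv M (\<lambda>x \<omega>. U b x \<omega> - U (prod.swap b) (prod.swap x) \<omega>)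
      (\<lambda>\<omega>. W a b x \<omega> - W (prod.swap a) (prod.swap b) (prod.swap x) \<omega>) a x"
    by (intro has_ms_deriv_diff W_has_ms_deriv has_ms_deriv_linear_compose[OF linear_swap])
  then have *: "has_ms_deriv M (ms_deriv M b f)
      (\<lambda>\<omega>. W a b x \<omega> - W (prod.swap a) (prod.swap b) (prod.swap x) \<omega>) a x"
    by (rule has_ms_deriv_cong_AE) (simp_all add: f_deriv_AE)
  note d = ms_deriv_works[OF *]
  show ?thesis
    by (rule represents_cong_AE[OF u_sq represents_diff[OF u_sq represents_W represents_W]
          has_ms_deriv_square_integrable(2)[OF d] has_ms_deriv_unique[OF * d]])
qed

text \<open>In terms of the displacement \<open>a = (v, w)\<close> and its swap \<open>a'\<close>, the linear part of the Taylor
  polynomial is the derivative of \<open>u\<close> along \<open>a - a'\<close>. The quadratic part is half the difference of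
  the second derivatives along \<open>a\<close> and along \<open>a'\<close>, which factors into the mixed derivative along
  \<open>d = a - a'\<close> and \<open>s = a + a'\<close>. On the level of covariances with \<open>u\<close> this factorisation is plain
  algebra, since \<open>D1\<close> and \<open>D2\<close> are visibly linear in their directions.\<close>

lemma represents_taylor2:
  fixes zs v w :: "real ^ 'n"
  defines "d \<equiv> (v - w, w - v)" and "s \<equiv> (v + w, v + w)"
  shows "represents M u (taylor2 M f zs (zs + v, zs + w))
    (\<lambda>y. D1 d ((zs, zs) - y) + 1 / 2 * D2 d s ((zs, zs) - y))"
proof -
  define g where "g i = ms_deriv M (dir1 i) f (zs, zs)" for i
  define H11 where "H11 i j = ms_deriv M (dir1 i) (ms_deriv M (dir1 j) f) (zs, zs)" for i j
  define H12 where "H12 i j = ms_deriv M (dir1 i) (ms_deriv M (dir2 j) f) (zs, zs)" for i j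
  have taylor2: "taylor2 M f zs (zs + v, zs + w) = (\<lambda>\<omega>.
      (\<Sum>i\<in>UNIV. (v - w) $ i * g i \<omega>)
      + 1 / 2 * ((\<Sum>i\<in>UNIV. v $ i * (\<Sum>j\<in>UNIV. v $ j * H11 i j \<omega>))
               - (\<Sum>i\<in>UNIV. w $ i * (\<Sum>j\<in>UNIV. w $ j * H11 i j \<omega>)))
      + (\<Sum>i\<in>UNIV. v $ i * (\<Sum>j\<in>UNIV. w $ j * H12 i j \<omega>)))"
    by (rule ext) (simp add: taylor2_def Let_def grad1_def hess11_def hess12_def inner_vec_def
        matrix_vector_mult_def g_def H11_def H12_def mult.commute)
  define p q where "p y = zs - fst y" and "q y = zs - snd y" for y :: "(real ^ 'n) \<times> (real ^ 'n)"
  define c c' where "c y = 4 * h'' (((zs, zs) - y) \<bullet> ((zs, zs) - y))"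
    and "c' y = 2 * h' (((zs, zs) - y) \<bullet> ((zs, zs) - y))" for y
  have g: "represents M u (g i) (\<lambda>y. c' y * (p y - q y) $ i)" for i
    using represents_f_deriv[of "dir1 i" "(zs, zs)"]
    by (simp add: g_def D1_def dir1_def inner_axis inner_prod_def c'_def p_def q_def algebra_simps)
  have H11: "represents M u (H11 i j) (\<lambda>y. c y * (p y $ i * p y $ j - q y $ i * q y $ j))" for i j
    using represents_f_deriv2[of "dir1 i" "dir1 j" "(zs, zs)"]
    by (simp add: H11_def D2_def dir1_def inner_axis inner_prod_def c_def p_def q_def algebra_simps)
  have H12: "represents M u (H12 i j) (\<lambda>y. c y * (p y $ i * q y $ j - q y $ i * p y $ j))" for i j
    using represents_f_deriv2[of "dir1 i" "dir2 j" "(zs, zs)"]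
    by (simp add: H12_def D2_def dir1_def dir2_def inner_axis inner_prod_def c_def p_def q_def algebra_simps)
  note rules = represents_add[OF u_sq] represents_diff[OF u_sq] represents_cmult represents_sum[OF u_sq]
  have rep: "represents M u (taylor2 M f zs (zs + v, zs + w)) (\<lambda>y.
      (\<Sum>i\<in>UNIV. (v - w) $ i * (c' y * (p y - q y) $ i))
      + 1 / 2 * ((\<Sum>i\<in>UNIV. v $ i * (\<Sum>j\<in>UNIV. v $ j * (c y * (p y $ i * p y $ j - q y $ i * q y $ j))))
               - (\<Sum>i\<in>UNIV. w $ i * (\<Sum>j\<in>UNIV. w $ j * (c y * (p y $ i * p y $ j - q y $ i * q y $ j)))))
      + (\<Sum>i\<in>UNIV. v $ i * (\<Sum>j\<in>UNIV. w $ j * (c y * (p y $ i * q y $ j - q y $ i * p y $ j)))))"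
    unfolding taylor2 by (intro rules g H11 H12)
  have linear_part: "(\<Sum>i\<in>UNIV. (v - w) $ i * (c' y * (p y - q y) $ i)) = D1 d ((zs, zs) - y)" for y
  proof -
    have zy: "(zs, zs) - y = (p y, q y)" by (simp add: p_def q_def prod_eq_iff)
    have "(\<Sum>i\<in>UNIV. (v - w) $ i * (c' y * (p y - q y) $ i)) = c' y * ((p y - q y) \<bullet> (v - w))"
      by (simp add: inner_vec_def sum_distrib_left mult_ac)
    also have "\<dots> = D1 d (p y, q y)"
      by (simp add: D1_def c'_def zy d_def inner_prod_def algebra_simps)
    finally show ?thesis unfolding zy .
  qed
  have quadratic_part: "1 / 2 * (c y * ((p y \<bullet> v) * (p y \<bullet> v) - (q y \<bullet> v) * (q y \<bullet> v))
      - c y * ((p y \<bullet> w) * (p y \<bullet> w) - (q y \<bullet> w) * (q y \<bullet> w)))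
      + c y * ((p y \<bullet> v) * (q y \<bullet> w) - (q y \<bullet> v) * (p y \<bullet> w)) = 1 / 2 * D2 d s ((zs, zs) - y)" for y
  proof -
    have zy: "(zs, zs) - y = (p y, q y)" by (simp add: p_def q_def prod_eq_iff)
    (* Both sides are the difference of the squares of p.v + q.w and q.v + p.w, up to a factor. *)
    have "D2 d s (p y, q y) = c y * ((p y - q y) \<bullet> (v - w)) * ((p y + q y) \<bullet> (v + w))"
      by (simp add: D2_def c_def zy d_def s_def inner_prod_def algebra_simps)
    then show ?thesis unfolding zy by (simp add: algebra_simps inner_commute)
  qed
  show ?thesis
    using rep unfolding sum_bilinear_minor linear_part add.assoc quadratic_part .
qed

end

section \<open>The variance of the Taylor error\<close>

text \<open>This is where Gaussianity enters: it places the field in \<open>L\<^sup>2\<close>.\<close>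

lemma gaussian_rv_square_integrable:
  assumes "prob_space M" "gaussian_rv M X"
  shows "square_integrable M X"
proof -
  interpret prob_space M by fact
  have [measurable]: "X \<in> borel_measurable M"
    using assms(2) by (simp add: gaussian_rv_def)
  consider \<mu> \<sigma> where "\<sigma> > 0" "distributed M lborel X (\<lambda>t. ennreal (normal_density \<mu> \<sigma> t))"
    | \<mu> where "AE \<omega> in M. X \<omega> = \<mu>"
    using assms(2) by (auto simp: gaussian_rv_def)
  then show ?thesis
  proof cases
    case (1 \<mu> \<sigma>)
    have "integrable M (\<lambda>\<omega>. (X \<omega> - \<mu>)\<^sup>2)"
      using distributed_integrable[OF 1(2), of "\<lambda>x. (x - \<mu>)\<^sup>2"] integrable_normal_moment[OF 1(1)]
      by simp
    then have "square_integrable M (\<lambda>\<omega>. X \<omega> - \<mu>)" by (simp add: square_integrable_def)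
    from square_integrable_add[OF this square_integrable_const[OF prob_space_axioms, of \<mu>]]
    show ?thesis by simp
  next
    case (2 \<mu>)
    then have "AE \<omega> in M. (X \<omega>)\<^sup>2 = \<mu>\<^sup>2" by auto
    then have "integrable M (\<lambda>\<omega>. (X \<omega>)\<^sup>2) \<longleftrightarrow> integrable M (\<lambda>\<omega>. \<mu>\<^sup>2)"
      by (intro integrable_cong_AE) measurable
    then show ?thesis by (simp add: square_integrable_def)
  qed
qed

lemma isotropic_gaussian_field_imp_isotropic_field:
  fixes u :: "'p::real_inner \<Rightarrow> 'w \<Rightarrow> real"
  assumes M: "prob_space M" and u: "isotropic_gaussian_field M h u"
    and smooth: "times_cont_diff 4 (\<lambda>p. cov_fun M u (fst p) (snd p))"
    and h: "\<And>t. t \<ge> 0 \<Longrightarrow> (h has_real_derivative h' t) (at t within {0..})"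
      "\<And>t. t \<ge> 0 \<Longrightarrow> (h' has_real_derivative h'' t) (at t within {0..})" "continuous_on {0..} h''"
  shows "isotropic_field M u h h' h''"
proof (rule isotropic_field.intro)
  have cov: "cov_fun M u x y = h ((x - y) \<bullet> (x - y))" for x y
    using u by (simp add: isotropic_gaussian_field_def power2_norm_eq_inner)
  have "gaussian_rv M (\<lambda>\<omega>. \<Sum>y\<in>I. c y * u y \<omega>)" if "finite I" for I c
    using u that by (simp add: isotropic_gaussian_field_def gaussian_field_def)
  from gaussian_rv_square_integrable[OF M this, of "{x}" "\<lambda>_. 1" for x]
  show "square_integrable M (u x)" for x
    by simp
  show mean: "(\<integral>\<omega>. u x \<omega> \<partial>M) = 0" for x
    using u by (simp add: isotropic_gaussian_field_def)
  show "l2_inner M (u x) (u y) = h ((x - y) \<bullet> (x - y))" for x y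
    using cov[of x y] by (simp add: cov_fun_def cov_def mean l2_inner_def)
  show "times_cont_diff 4 (\<lambda>p::'p \<times> 'p. h ((fst p - snd p) \<bullet> (fst p - snd p)))"
    using smooth by (simp only: cov)
qed (rule M h | assumption)+

text \<open>If one of the vectors vanishes, both sides are 0 whatever \<open>\<theta>\<close> is.\<close>

lemma is_angle_inner:
  assumes "is_angle \<theta> v w"
  shows "v \<bullet> w = norm v * norm w * cos \<theta>"
  using assms by (cases "v = 0 \<or> w = 0") (auto simp: is_angle_def)

context isotropic_field_on_pairs
begin

text \<open>Expand the square of \<open>T - f x\<close>, where \<open>T\<close> is the Taylor polynomial. Its second moment is that of
  \<open>U d z + W d s z / 2\<close>; its covariance with \<open>f x\<close> is read off from the function that represents it;
  and the second moment of \<open>f x\<close> is given by \<open>h\<close> at 0 and at the squared distance of \<open>x\<close> and its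
  swap. The geometry is that \<open>d\<close> and \<open>s\<close> are orthogonal, because \<open>x - z\<close> and its swap have the same
  norm.\<close>

lemma variance_taylor_error:
  fixes zs v w :: "real ^ 'n"
  defines "R \<equiv> v \<bullet> v + w \<bullet> w" and "c \<equiv> v \<bullet> w"
  shows "prob_space.variance M (taylor_error M f zs (zs + v, zs + w)) =
    2 * (h 0 - h (2 * (R - 2 * c))) - 4 * (h' 0 - 2 * h' R) * (R - 2 * c)
    + 4 * (h'' 0 - 2 * h'' R) * (R\<^sup>2 - 4 * c\<^sup>2)"
proof -
  interpret prob_space M by (rule prob)
  define z where "z = (zs, zs)"
  define x where "x = (zs + v, zs + w)"
  define T where "T = taylor2 M f zs x"
  define d s where "d = (v - w, w - v)" and "s = (v + w, v + w)"
  define T' where "T' \<omega> = U d z \<omega> + 1 / 2 * W d s z \<omega>" for \<omega>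
  have ds: "d \<bullet> s = 0" and dd: "d \<bullet> d = 2 * (R - 2 * c)" and ss: "s \<bullet> s = 2 * (R + 2 * c)"
    by (simp_all add: d_def s_def R_def c_def inner_prod_def algebra_simps inner_commute)
  have swap: "prod.swap x = (zs + w, zs + v)" by (simp add: x_def)
  have T: "represents M u T (\<lambda>y. D1 d (z - y) + 1 / 2 * D2 d s (z - y))"
    unfolding T_def x_def z_def d_def s_def by (rule represents_taylor2)
  have T': "represents M u T' (\<lambda>y. D1 d (z - y) + 1 / 2 * D2 d s (z - y))"
    unfolding T'_def[abs_def]
    by (intro represents_add represents_cmult represents_U represents_W u_sq)
  have f: "represents M u (f x) (\<lambda>y. h ((x - y) \<bullet> (x - y)) - h ((prod.swap x - y) \<bullet> (prod.swap x - y)))"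
    unfolding block_field_def[abs_def] by (intro represents_diff represents_u u_sq)
  note sq [simp] = T[THEN represents_square_integrable] T'[THEN represents_square_integrable]
    f[THEN represents_square_integrable]
  have AE: "AE \<omega> in M. T \<omega> = T' \<omega>"
    by (rule represents_unique[OF u_sq T T'])
  have TT: "l2_inner M T T = - 4 * h' 0 * (R - 2 * c) + 4 * h'' 0 * (R\<^sup>2 - 4 * c\<^sup>2)"
  proof -
    have "l2_inner M T T = l2_inner M T' T'"
      using l2_inner_cong_AE[OF sq(1,2,1) AE] l2_inner_cong_AE[OF sq(1,2,2) AE]
      by (simp add: l2_inner_commute[of M T' T])
    also have "\<dots> = - 2 * h' 0 * (d \<bullet> d) + h'' 0 * (d \<bullet> d) * (s \<bullet> s)"
      unfolding T'_def[abs_def] by (rule taylor_polynomial_norm[OF ds])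
    finally show ?thesis
      unfolding dd ss by (simp add: algebra_simps power2_eq_square)
  qed
  have Tf: "l2_inner M T (f x) = - 4 * h' R * (R - 2 * c) + 4 * h'' R * (R\<^sup>2 - 4 * c\<^sup>2)"
  proof -
    have "l2_inner M T (f x) = l2_inner M T (u x) - l2_inner M T (u (prod.swap x))"
      unfolding block_field_def[of u x, abs_def] by (simp add: l2_inner_diff_right)
    \<comment> \<open>The points \<open>(- v, - w)\<close> and \<open>(- w, - v)\<close> are \<open>z - x\<close> and \<open>z - swap x\<close>.\<close>
    also have "\<dots> = (D1 d (- v, - w) + 1 / 2 * D2 d s (- v, - w)) - (D1 d (- w, - v) + 1 / 2 * D2 d s (- w, - v))"
      unfolding represents_inner[OF T] swap by (simp add: z_def x_def)
    also have "\<dots> = - 4 * h' R * (R - 2 * c) + 4 * h'' R * (R\<^sup>2 - 4 * c\<^sup>2)"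
    proof -
      have inner: "(- v, - w) \<bullet> (- v, - w) = R" "(- w, - v) \<bullet> (- w, - v) = R"
        "(- v, - w) \<bullet> d = - (R - 2 * c)" "(- w, - v) \<bullet> d = R - 2 * c"
        "(- v, - w) \<bullet> s = - (R + 2 * c)" "(- w, - v) \<bullet> s = - (R + 2 * c)"
        using inner_commute[of w v]
        by (simp_all add: d_def s_def R_def c_def inner_diff_right inner_add_right)
      show ?thesis
        unfolding D1_def D2_def ds inner by (simp add: algebra_simps power2_eq_square)
    qed
    finally show ?thesis .
  qed
  have ff: "l2_inner M (f x) (f x) = 2 * (h 0 - h (2 * (R - 2 * c)))"
  proof -
    have "l2_inner M (f x) (f x) = l2_inner M (f x) (u x) - l2_inner M (f x) (u (prod.swap x))"
      using l2_inner_diff_right[of M "u x" "u (prod.swap x)" "f x"]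
      unfolding block_field_def[of u x, abs_def] by simp
    also have "\<dots> = 2 * (h 0 - h (d \<bullet> d))"
    proof -
      have "x - prod.swap x = d" "prod.swap x - x = - d"
        by (simp_all add: x_def d_def)
      then show ?thesis unfolding represents_inner[OF f] by simp
    qed
    finally show ?thesis unfolding dd .
  qed
  have "expectation (\<lambda>\<omega>. T \<omega> - f x \<omega>) = 0"
    by (rule represents_mean_zero[OF prob u_mean represents_diff[OF u_sq T f]])
  then have "variance (taylor_error M f zs x) = l2_inner M (\<lambda>\<omega>. T \<omega> - f x \<omega>) (\<lambda>\<omega>. T \<omega> - f x \<omega>)"
    by (simp add: taylor_error_def[abs_def] l2_inner_self T_def)
  also have "\<dots> = l2_inner M T T - 2 * l2_inner M T (f x) + l2_inner M (f x) (f x)"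
    by (simp add: l2_inner_simps l2_inner_commute[of M "f x" T])
  finally have "variance (taylor_error M f zs x) = \<dots>" .
  then show ?thesis
    unfolding x_def[symmetric] TT Tf ff by (simp add: algebra_simps)
qed

end

theorem theorem30:
  fixes M :: "'w measure"
    and u :: "(real ^ 'n::finite) \<times> (real ^ 'n) \<Rightarrow> 'w \<Rightarrow> real"
    and h h' h'' :: "real \<Rightarrow> real"
    and zs :: "real ^ 'n"
  assumes "prob_space M"
    and "isotropic_gaussian_field M h u"
    and "times_cont_diff 4 (\<lambda>p. cov_fun M u (fst p) (snd p))"
    and "\<And>t. t \<ge> 0 \<Longrightarrow> (h has_real_derivative h' t) (at t within {0..})"
    and "\<And>t. t \<ge> 0 \<Longrightarrow> (h' has_real_derivative h'' t) (at t within {0..})"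
    and "continuous_on {0..} h''"
  defines "V \<equiv> \<lambda>x1 x2. prob_space.variance M (taylor_error M (block_field u) zs (x1, x2))"
  shows "(\<forall>x1 x2 y1 y2 \<theta>.
            norm (x1 - zs) = norm (y1 - zs) \<and> norm (x2 - zs) = norm (y2 - zs) \<and>
            is_angle \<theta> (x1 - zs) (x2 - zs) \<and> is_angle \<theta> (y1 - zs) (y2 - zs)
            \<longrightarrow> V x1 x2 = V y1 y2) \<and>
         (\<forall>x1 x2 r1 r2 \<theta>.
            r1 = norm (x1 - zs) \<and> r2 = norm (x2 - zs) \<and> is_angle \<theta> (x1 - zs) (x2 - zs)
            \<longrightarrow> V x1 x2 =
              2 * (h 0 - h (2 * (r1\<^sup>2 + r2\<^sup>2 - 2 * r1 * r2 * cos \<theta>)))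
              - 4 * (h' 0 - 2 * h' (r1\<^sup>2 + r2\<^sup>2)) * (r1\<^sup>2 + r2\<^sup>2 - 2 * r1 * r2 * cos \<theta>)
              + 4 * (h'' 0 - 2 * h'' (r1\<^sup>2 + r2\<^sup>2))
                  * ((r1\<^sup>2 + r2\<^sup>2)\<^sup>2 - 4 * r1\<^sup>2 * r2\<^sup>2 * (cos \<theta>)\<^sup>2))"
proof -
  interpret isotropic_field_on_pairs M u h h' h''
    unfolding isotropic_field_on_pairs_def
    by (rule isotropic_gaussian_field_imp_isotropic_field[OF assms(1-6)])
  have V: "V x1 x2 =
      2 * (h 0 - h (2 * (r1\<^sup>2 + r2\<^sup>2 - 2 * r1 * r2 * cos \<theta>)))
      - 4 * (h' 0 - 2 * h' (r1\<^sup>2 + r2\<^sup>2)) * (r1\<^sup>2 + r2\<^sup>2 - 2 * r1 * r2 * cos \<theta>)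
      + 4 * (h'' 0 - 2 * h'' (r1\<^sup>2 + r2\<^sup>2)) * ((r1\<^sup>2 + r2\<^sup>2)\<^sup>2 - 4 * r1\<^sup>2 * r2\<^sup>2 * (cos \<theta>)\<^sup>2)"
    if "r1 = norm (x1 - zs)" "r2 = norm (x2 - zs)" "is_angle \<theta> (x1 - zs) (x2 - zs)" for x1 x2 r1 r2 \<theta>
  proof -
    have R: "(x1 - zs) \<bullet> (x1 - zs) + (x2 - zs) \<bullet> (x2 - zs) = r1\<^sup>2 + r2\<^sup>2"
      by (simp only: that(1,2) power2_norm_eq_inner)
    have c: "(x1 - zs) \<bullet> (x2 - zs) = r1 * r2 * cos \<theta>"
      by (simp only: that(1,2) is_angle_inner[OF that(3)])
    show ?thesis
      using variance_taylor_error[of zs "x1 - zs" "x2 - zs"]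
      unfolding R c V_def by (simp add: power_mult_distrib mult.assoc)
  qed
  show ?thesis
  proof (intro conjI allI impI; elim conjE)
    fix x1 x2 y1 y2 \<theta>
    assume norms: "norm (x1 - zs) = norm (y1 - zs)" "norm (x2 - zs) = norm (y2 - zs)"
      and angle: "is_angle \<theta> (x1 - zs) (x2 - zs)" "is_angle \<theta> (y1 - zs) (y2 - zs)"
    show "V x1 x2 = V y1 y2"
      unfolding V[OF refl refl angle(1)] V[OF refl refl angle(2)] norms ..
  qed (rule V)
qed

end
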